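(* Let $W$ be a finite reflection group and $S$ a generating set of simple reflections of $W$. Then for any disjoint subsets $S_1,S_2\subseteq S$, the $(S_1,S_2;S,W)$-reflection graph is norming.
   Context: A finite reflection group is a finite subgroup $W$ of $\mathbf{GL}(n,\mathbb{R})$ generated by reflections across hyperplanes through the origin. With roots the unit normals of reflecting hyperplanes, positive roots those whose first nonzero coordinate in a fixed ordered basis is positive, and a simple system $\Delta$ a minimal set of positive roots such that all positive roots are non-negative combinations of $\Delta$, the simple reflections are the reflections in hyperplanes orthogonal to elements of $\Delta$; they generate $W$. For $S_1,S_2\subseteq S$ let $W_i=\langle S_i\rangle$. The $(S_1,S_2;S,W)$-reflection graph is the bipartite graph between the left cosets of $W_1$ (first part) and the left cosets of $W_2$ (second part), with $wW_1$ adjacent to $wW_2$ for every $w\in W$. For a bipartite graph $H$ with bipartition $(A,B)$ and bounded measurable $f:[0,1]^2\to\mathbb{R}$, $\|f\|_{H}:=\left|\int\prod_{ij\in E(H), i\in A, j\in B}f(x_i,x_j)\,d\mu^{|V(H)|}\right|^{1/|E(H)|}$ with $\mu$ Lebesgue measure; $H$ is norming if $\|\cdot\|_H$ is a semi-norm on the space of bounded measurable functions on $[0,1]^2$. *)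

theory Defs
  imports "HOL-Analysis.Analysis" "HOL-Algebra.Generated_Groups"
begin

section \<open>Finite reflection groups\<close>

definition GL :: "(real^'n^'n) monoid" where
  "GL = \<lparr>carrier = {A. invertible A}, mult = (**), one = mat 1\<rparr>"

lemma group_GL: "group GL"
proof (rule groupI)
  fix A :: "real^'n^'n"
  assume "A \<in> carrier GL"
  then obtain B where "A ** B = mat 1" "B ** A = mat 1"
    by (auto simp: GL_def invertible_def)
  then show "\<exists>B\<in>carrier GL. B \<otimes>\<^bsub>GL\<^esub> A = \<one>\<^bsub>GL\<^esub>"
    by (auto simp: GL_def invertible_def)
qed (auto simp: GL_def invertible_mult matrix_mul_assoc invertible_def[of "mat 1"])

text \<open>The matrix of the orthogonal reflection across the hyperplane through the origin with
  normal vector \<open>a\<close>; it is a reflection only for \<open>a \<noteq> 0\<close>.\<close>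

definition reflection :: "real^'n \<Rightarrow> real^'n^'n" where
  "reflection a = matrix (\<lambda>x. x - (2 * (x \<bullet> a) / (a \<bullet> a)) *\<^sub>R a)"

definition finite_reflection_group :: "(real^'n^'n) set \<Rightarrow> bool" where
  "finite_reflection_group W \<longleftrightarrow>
     finite W \<and> subgroup W GL \<and> (\<exists>R \<subseteq> reflection ` {a. a \<noteq> 0}. W = generate GL R)"

definition roots :: "(real^'n^'n) set \<Rightarrow> (real^'n) set" where
  "roots W = {a. norm a = 1 \<and> reflection a \<in> W}"

definition ordered_basis :: "(real^'n) list \<Rightarrow> bool" where
  "ordered_basis bs \<longleftrightarrow> distinct bs \<and> independent (set bs) \<and> span (set bs) = UNIV"

definition positive_wrt :: "(real^'n) list \<Rightarrow> real^'n \<Rightarrow> bool" where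
  "positive_wrt bs v \<longleftrightarrow>
     (\<exists>i<length bs. representation (set bs) v (bs ! i) > 0 \<and>
        (\<forall>j<i. representation (set bs) v (bs ! j) = 0))"

definition positive_roots :: "(real^'n) list \<Rightarrow> (real^'n^'n) set \<Rightarrow> (real^'n) set" where
  "positive_roots bs W = {a \<in> roots W. positive_wrt bs a}"

text \<open>Only used for subsets of \<open>roots W\<close>, which are finite when \<open>W\<close> is; the sum is therefore
  a genuine one.\<close>

definition nonneg_combination :: "(real^'n) set \<Rightarrow> real^'n \<Rightarrow> bool" where
  "nonneg_combination D v \<longleftrightarrow> (\<exists>c. (\<forall>d\<in>D. 0 \<le> c d) \<and> v = (\<Sum>d\<in>D. c d *\<^sub>R d))"

definition simple_system :: "(real^'n) list \<Rightarrow> (real^'n^'n) set \<Rightarrow> (real^'n) set \<Rightarrow> bool" where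
  "simple_system bs W D \<longleftrightarrow>
     D \<subseteq> positive_roots bs W \<and>
     (\<forall>v \<in> positive_roots bs W. nonneg_combination D v) \<and>
     (\<forall>D'. D' \<subset> D \<longrightarrow> \<not> (\<forall>v \<in> positive_roots bs W. nonneg_combination D' v))"

section \<open>Bipartite graphs and norms\<close>

text \<open>The two parts are disjoint by typing: a vertex is \<open>Inl i\<close> or \<open>Inr j\<close>, even if the sets
  \<open>left_part H\<close> and \<open>right_part H\<close> have common elements.\<close>

record ('a, 'b) bipartite_graph =
  left_part :: "'a set"
  right_part :: "'b set"
  edges :: "('a \<times> 'b) set"

definition reflection_graph ::
  "(real^'n^'n) set \<Rightarrow> (real^'n^'n) set \<Rightarrow> (real^'n^'n) set
     \<Rightarrow> ((real^'n^'n) set, (real^'n^'n) set) bipartite_graph" where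
  "reflection_graph S1 S2 W =
     (let W1 = generate GL S1; W2 = generate GL S2
      in \<lparr>left_part = (\<lambda>w. w <#\<^bsub>GL\<^esub> W1) ` W,
          right_part = (\<lambda>w. w <#\<^bsub>GL\<^esub> W2) ` W,
          edges = (\<lambda>w. (w <#\<^bsub>GL\<^esub> W1, w <#\<^bsub>GL\<^esub> W2)) ` W\<rparr>)"

definition vertices :: "('a, 'b) bipartite_graph \<Rightarrow> ('a + 'b) set" where
  "vertices H = left_part H <+> right_part H"

text \<open>Functions on the unit square are represented by functions on the plane; their values outside
  the square play no role. Measurable means Lebesgue measurable.\<close>

definition bounded_measurable :: "(real \<times> real \<Rightarrow> real) set" where
  "bounded_measurable =
     {f. f \<in> borel_measurable (lebesgue_on ({0..1} \<times> {0..1})) \<and> bounded (f ` ({0..1} \<times> {0..1}))}"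

text \<open>Lebesgue measure on the cube \<open>[0,1]\<^sup>V\<close>. The completion is needed since \<open>f (x\<^sub>i, x\<^sub>j)\<close> need
  not be measurable for the product \<open>\<sigma>\<close>-algebra when \<open>f\<close> is merely Lebesgue measurable.\<close>

definition cube_measure :: "'v set \<Rightarrow> ('v \<Rightarrow> real) measure" where
  "cube_measure V = completion (\<Pi>\<^sub>M v\<in>V. restrict_space lborel {0..1})"

definition graph_norm :: "('a, 'b) bipartite_graph \<Rightarrow> (real \<times> real \<Rightarrow> real) \<Rightarrow> real" where
  "graph_norm H f =
     \<bar>LINT x|cube_measure (vertices H). (\<Prod>(i, j)\<in>edges H. f (x (Inl i), x (Inr j)))\<bar>
       powr (1 / real (card (edges H)))"

definition seminorm_on :: "('x \<Rightarrow> real) set \<Rightarrow> (('x \<Rightarrow> real) \<Rightarrow> real) \<Rightarrow> bool" where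
  "seminorm_on V p \<longleftrightarrow>
     (\<forall>f\<in>V. 0 \<le> p f) \<and>
     (\<forall>f\<in>V. \<forall>c. p (\<lambda>x. c * f x) = \<bar>c\<bar> * p f) \<and>
     (\<forall>f\<in>V. \<forall>g\<in>V. p (\<lambda>x. f x + g x) \<le> p f + p g)"

definition norming :: "('a, 'b) bipartite_graph \<Rightarrow> bool" where
  "norming H \<longleftrightarrow> seminorm_on bounded_measurable (graph_norm H)"

end

theory Submission
  imports Defs "HOL-Probability.Probability"
begin

text \<open>
  Since \<open>W\<^sub>1\<close> and \<open>W\<^sub>2\<close> intersect trivially, the edges of the graph correspond to the elements of
  \<open>W\<close>. Decorate each edge \<open>w\<close> with its own function \<open>f w\<close> and let \<open>I f\<close> be the resulting integral.
  The hyperplane of a root cuts \<open>W\<close> into two halves exchanged by the reflection; a vertex lies on one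
  side unless the reflection fixes it, and no edge joins two fixed vertices. Given the fixed
  vertices, the integral is therefore a product of one factor for each side, and Cauchy-Schwarz
  yields \<open>(I f)\<^sup>2 \<le> I f\<^sup>+ * I f\<^sup>-\<close>, where \<open>f\<^sup>+\<close> and \<open>f\<^sup>-\<close> copy one half of the decoration onto the
  other. Repeated folding towards the chamber of an edge spreads its decoration to the whole of \<open>W\<close>,
  since reflections move chambers closer to it. Hence a maximiser of \<open>\<bar>I f\<bar>\<close>, suitably normalised,
  may be taken constant, which is the Hoelder inequality \<open>\<bar>I f\<bar> \<le> (\<Prod>w. \<parallel>f w\<parallel>)\<close>. Expanding
  \<open>\<parallel>f + g\<parallel>\<close> multilinearly gives the triangle inequality.
\<close>

section \<open>Simple reflections\<close>

text \<open>Chambers guide the proof: \<open>w\<close> stands for the chamber with centre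
  \<open>w *v rho\<close>, a coset for a face shared by its chambers. All centres have the same
  norm, so their inner products measure closeness. Reflecting \<open>w\<close> across a hyperplane
  that separates it from \<open>w0\<close> strictly raises its inner product with \<open>w0\<close>;
  this strict increase is why folding reaches every edge.

  Disjointness of the two sets of simple reflections enters through linear independence: a simple
  root made negative by an element of both subgroups would lie in the spans of both sets of simple
  roots. Since simple systems are defined by minimality, independence must first be earned: positive
  vectors cannot cancel, hence simple roots form obtuse angles, hence they are independent. No edge
  joins two fixed vertices because \<open>w\<close> and its mirror image would then be the same
  edge.

  The normalised quantity is \<bar>I f\<bar> to the power |W|, divided by the product of the
  \<bar>I\<bar> of the constant decorations. It does not change when a single function is rescaled.
  Folding only redistributes the given functions, so finitely many decorations compete and a
  maximiser exists without any compactness.\<close>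

declare transpose_matrix_vector [simp del]

section \<open>Matrices of reflections and words in them\<close>

lemma inner_transpose: "(transpose A *v x) \<bullet> y = x \<bullet> (A *v y)" for A :: "real^'n^'n"
  by (simp add: dot_lmul_matrix transpose_matrix_vector)

lemma reflection_vec: "reflection a *v x = x - (2 * (x \<bullet> a) / (a \<bullet> a)) *\<^sub>R a"
proof -
  have "linear (\<lambda>x. x - (2 * (x \<bullet> a) / (a \<bullet> a)) *\<^sub>R a)"
    by (rule linearI) (auto simp: inner_add_left algebra_simps add_divide_distrib)
  then show ?thesis
    by (simp add: reflection_def matrix_works)
qed

lemma reflection_reflection_vec: "a \<noteq> 0 \<Longrightarrow> reflection a *v (reflection a *v x) = x"
  by (simp add: reflection_vec inner_diff_left)

lemma reflection_involution: "a \<noteq> 0 \<Longrightarrow> reflection a ** reflection a = mat 1"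
  by (simp add: matrix_eq matrix_vector_mul_assoc[symmetric] reflection_reflection_vec)

lemma reflection_scaleR: "c \<noteq> 0 \<Longrightarrow> reflection (c *\<^sub>R a) = reflection a"
  by (simp add: matrix_eq reflection_vec)

lemma reflection_minus: "reflection (- a) = reflection a"
  using reflection_scaleR[of "-1" a] by simp

lemma inner_reflection: "(reflection a *v x) \<bullet> y = x \<bullet> (reflection a *v y)"
  by (simp add: reflection_vec inner_diff_left inner_diff_right inner_commute)

lemma transpose_reflection: "transpose (reflection a) = reflection a"
proof -
  have "(transpose (reflection a) *v x) \<bullet> y = (reflection a *v x) \<bullet> y" for x y
    by (simp add: inner_reflection inner_transpose)
  then show ?thesis
    by (metis matrix_eq vector_eq_rdot)
qed

lemma reflection_root_vec:
  "norm a = 1 \<Longrightarrow> reflection a *v x = x - (2 * (x \<bullet> a)) *\<^sub>R a"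
  by (simp add: reflection_vec dot_square_norm)

text \<open>Evaluating both reflections at \<open>a\<close> shows that \<open>a\<close> is a
  multiple of \<open>b\<close>; unit length leaves only the two signs.\<close>

lemma reflection_eq_imp:
  assumes "norm a = 1" "norm b = 1" "reflection a = reflection b"
  shows "a = b \<or> a = - b"
proof -
  have "reflection b *v a = - a"
    using reflection_root_vec[OF assms(1), of a] assms
    by (simp add: dot_square_norm scaleR_2)
  then have "2 *\<^sub>R a = 2 *\<^sub>R ((a \<bullet> b) *\<^sub>R b)"
    using reflection_root_vec[OF assms(2), of a] by (simp add: scaleR_2 algebra_simps)
  then have *: "a = (a \<bullet> b) *\<^sub>R b"
    by (rule scaleR_left_imp_eq[rotated]) simp
  then have "norm a = \<bar>a \<bullet> b\<bar> * norm b"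
    by (metis norm_scaleR)
  then have "a \<bullet> b = 1 \<or> a \<bullet> b = - 1"
    using assms(1,2) by (simp add: abs_if split: if_splits)
  then show ?thesis
    using * by (metis scaleR_minus1_left scaleR_one)
qed

text \<open>Words are kept as lists because the exchange argument needs their length and an
  induction over their letters.\<close>

definition refl_prod :: "(real^'n) list \<Rightarrow> real^'n^'n" where
  "refl_prod ds = foldr (\<lambda>d A. reflection d ** A) ds (mat 1)"

lemma refl_prod_simps [simp]:
  "refl_prod [] = mat 1" "refl_prod (d # ds) = reflection d ** refl_prod ds"
  by (simp_all add: refl_prod_def)

lemma refl_prod_append: "refl_prod (xs @ ys) = refl_prod xs ** refl_prod ys"
  by (induction xs) (simp_all add: matrix_mul_assoc)

interpretation GL: group GL
  by (rule group_GL)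

lemma GL_simps [simp]:
  "x \<otimes>\<^bsub>GL\<^esub> y = x ** y" "\<one>\<^bsub>GL\<^esub> = mat 1" "x \<in> carrier GL \<longleftrightarrow> invertible x"
  by (simp_all add: GL_def)

lemma invertible_reflection: "a \<noteq> 0 \<Longrightarrow> invertible (reflection a)"
  using reflection_involution invertible_def by blast

lemma inv_reflection: "a \<noteq> 0 \<Longrightarrow> inv\<^bsub>GL\<^esub> (reflection a) = reflection a"
  by (rule GL.inv_equality) (simp_all add: reflection_involution invertible_reflection)

text \<open>A reflection is its own inverse, so words without inverse letters already form the
  generated subgroup.\<close>

lemma generate_reflections_iff:
  assumes "0 \<notin> D"
  shows "w \<in> generate GL (reflection ` D) \<longleftrightarrow> (\<exists>ds. set ds \<subseteq> D \<and> w = refl_prod ds)"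
proof
  assume "w \<in> generate GL (reflection ` D)"
  then show "\<exists>ds. set ds \<subseteq> D \<and> w = refl_prod ds"
  proof induction
    case one
    show ?case by (rule exI[of _ "[]"]) simp
  next
    case (incl h)
    then obtain d where "d \<in> D" "h = reflection d" by auto
    then show ?case by (intro exI[of _ "[d]"]) simp
  next
    case (inv h)
    then obtain d where "d \<in> D" "h = reflection d" by auto
    moreover from this assms have "d \<noteq> 0" by auto
    ultimately show ?case by (intro exI[of _ "[d]"]) (simp add: inv_reflection)
  next
    case (eng h1 h2)
    then obtain xs ys where "set xs \<subseteq> D" "h1 = refl_prod xs" "set ys \<subseteq> D" "h2 = refl_prod ys"
      by auto
    then show ?case by (intro exI[of _ "xs @ ys"]) (simp add: refl_prod_append)
  qed
next
  assume "\<exists>ds. set ds \<subseteq> D \<and> w = refl_prod ds"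
  then obtain ds where "set ds \<subseteq> D" "w = refl_prod ds" by auto
  then show "w \<in> generate GL (reflection ` D)"
  proof (induction ds arbitrary: w)
    case Nil
    then show ?case using generate.one[of GL] by simp
  next
    case (Cons d ds)
    then have "reflection d \<otimes>\<^bsub>GL\<^esub> refl_prod ds \<in> generate GL (reflection ` D)"
      by (intro generate.eng[OF generate.incl]) auto
    with Cons.prems show ?case by simp
  qed
qed

lemma orthogonal_refl_prod: "0 \<notin> set ds \<Longrightarrow> orthogonal_matrix (refl_prod ds)"
proof (induction ds)
  case (Cons d ds)
  then show ?case
    by (auto intro!: orthogonal_matrix_mul
        simp: orthogonal_matrix[of "reflection d"] transpose_reflection reflection_involution)
qed (simp add: orthogonal_matrix_id)

text \<open>Of the lexicographic order only its compatibility with sums and positive multiples and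
  the dichotomy of signs matter, so the basis is abstracted to a predicate \<open>pos\<close>.
  Minimality is kept as in the definition of a simple system; \<open>simple_independent\<close> is
  derived from it.\<close>

locale simple_reflections =
  fixes W :: "(real^'n^'n) set" and pos :: "real^'n \<Rightarrow> bool" and \<Delta> :: "(real^'n) set"
  assumes frg: "finite_reflection_group W"
    and pos_add: "pos x \<Longrightarrow> pos y \<Longrightarrow> pos (x + y)"
    and pos_scaleR: "0 < c \<Longrightarrow> pos x \<Longrightarrow> pos (c *\<^sub>R x)"
    and not_pos_0: "\<not> pos 0"
    and pos_cases: "x \<noteq> 0 \<Longrightarrow> pos x \<or> pos (- x)"
    and simple_pos: "\<Delta> \<subseteq> {a \<in> roots W. pos a}"
    and simple_comb: "a \<in> roots W \<Longrightarrow> pos a \<Longrightarrow> nonneg_combination \<Delta> a"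
    and simple_minimal: "D \<subset> \<Delta> \<Longrightarrow> \<exists>a\<in>roots W. pos a \<and> \<not> nonneg_combination D a"
begin

section \<open>Signs, orthogonality and the action on roots\<close>

lemma not_pos_minus: "pos x \<Longrightarrow> \<not> pos (- x)"
  using pos_add[of x "- x"] not_pos_0 by auto

lemma not_pos_iff: "x \<noteq> 0 \<Longrightarrow> \<not> pos x \<longleftrightarrow> pos (- x)"
  using not_pos_minus[of x] pos_cases by auto

lemma finite_W: "finite W" and subgroup_W: "subgroup W GL"
  using frg by (auto simp: finite_reflection_group_def)

text \<open>Products of reflections are orthogonal. From here on \<open>transpose w\<close> serves
  as the inverse of \<open>w\<close>.\<close>

lemma orthogonal_W: "w \<in> W \<Longrightarrow> orthogonal_matrix w"
proof -
  assume w: "w \<in> W"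
  obtain R where R: "R \<subseteq> reflection ` {a. a \<noteq> 0}" "W = generate GL R"
    using frg by (auto simp: finite_reflection_group_def)
  then have "w \<in> generate GL (reflection ` {a. a \<noteq> 0})"
    using w GL.mono_generate by blast
  then obtain ds where "set ds \<subseteq> {a. a \<noteq> 0}" "w = refl_prod ds"
    by (subst (asm) generate_reflections_iff) auto
  then show ?thesis using orthogonal_refl_prod by auto
qed

lemma one_W: "mat 1 \<in> W"
  using subgroup.one_closed[OF subgroup_W] by simp

lemma mult_W: "v \<in> W \<Longrightarrow> w \<in> W \<Longrightarrow> v ** w \<in> W"
  using subgroup.m_closed[OF subgroup_W] by simp

lemma inv_W_eq: "w \<in> W \<Longrightarrow> inv\<^bsub>GL\<^esub> w = transpose w"
proof (rule GL.inv_equality)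
  assume "w \<in> W"
  then have "orthogonal_matrix w" by (rule orthogonal_W)
  then show "transpose w \<otimes>\<^bsub>GL\<^esub> w = \<one>\<^bsub>GL\<^esub>" "w \<in> carrier GL" "transpose w \<in> carrier GL"
    by (auto simp: orthogonal_matrix_def invertible_def)
qed

lemma transpose_W: "w \<in> W \<Longrightarrow> transpose w \<in> W"
  using subgroup.m_inv_closed[OF subgroup_W] inv_W_eq by metis

lemma mult_transpose_W: "w \<in> W \<Longrightarrow> w ** transpose w = mat 1" "w \<in> W \<Longrightarrow> transpose w ** w = mat 1"
  using orthogonal_W by (auto simp: orthogonal_matrix_def)

lemma transpose_vec_W [simp]:
  "w \<in> W \<Longrightarrow> w *v (transpose w *v x) = x" "w \<in> W \<Longrightarrow> transpose w *v (w *v x) = x"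
  by (simp_all only: matrix_vector_mul_assoc mult_transpose_W matrix_vector_mul_lid)

lemma inner_W: "w \<in> W \<Longrightarrow> (w *v x) \<bullet> (w *v y) = x \<bullet> y"
  by (simp flip: inner_transpose)

lemma norm_W: "w \<in> W \<Longrightarrow> norm (w *v x) = norm x"
  by (simp add: norm_eq_sqrt_inner inner_W)

lemma reflection_conj: "w \<in> W \<Longrightarrow> reflection (w *v a) = w ** reflection a ** transpose w"
proof -
  assume w: "w \<in> W"
  have "reflection (w *v a) *v x = w *v (reflection a *v (transpose w *v x))" for x
    using w by (simp add: reflection_vec matrix_vector_mult_diff_distrib matrix_vector_mult_scaleR
        inner_transpose inner_W)
  then show ?thesis
    by (simp add: matrix_eq matrix_vector_mul_assoc[symmetric])
qed

lemma norm_root: "a \<in> roots W \<Longrightarrow> norm a = 1"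
  by (simp add: roots_def)

lemma root_neq_0: "a \<in> roots W \<Longrightarrow> a \<noteq> 0"
  by (auto simp: roots_def)

lemma reflection_in_W: "a \<in> roots W \<Longrightarrow> reflection a \<in> W"
  by (simp add: roots_def)

lemma reflection_root: "a \<in> roots W \<Longrightarrow> reflection a *v x = x - (2 * (x \<bullet> a)) *\<^sub>R a"
  by (simp add: norm_root reflection_root_vec)

lemma minus_root: "a \<in> roots W \<Longrightarrow> - a \<in> roots W"
  by (simp add: roots_def reflection_minus)

lemma W_root: "w \<in> W \<Longrightarrow> a \<in> roots W \<Longrightarrow> w *v a \<in> roots W"
  by (auto simp: roots_def norm_W reflection_conj intro!: mult_W transpose_W)

lemma reflection_self: "a \<in> roots W \<Longrightarrow> reflection a *v a = - a"
  by (simp add: reflection_root dot_square_norm norm_root scaleR_2)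

text \<open>By \<open>reflection_eq_imp\<close> each element of \<open>W\<close> is the reflection
  of at most two unit vectors.\<close>

lemma finite_roots: "finite (roots W)"
proof -
  have "finite {a. norm a = 1 \<and> reflection a = w}" for w :: "real^'n^'n"
  proof (cases "\<exists>b. norm b = 1 \<and> reflection b = w")
    case True
    then obtain b where "norm b = 1" "reflection b = w" by auto
    then have "{a. norm a = 1 \<and> reflection a = w} \<subseteq> {b, -b}"
      using reflection_eq_imp[of _ b] by auto
    then show ?thesis by (rule finite_subset) simp
  next
    case False
    then have E: "{a. norm a = 1 \<and> reflection a = w} = {}" by blast
    show ?thesis unfolding E by simp
  qed
  then have "finite (\<Union>w\<in>W. {a. norm a = 1 \<and> reflection a = w})"
    using finite_W by (intro finite_UN_I)
  then show ?thesis
    by (rule finite_subset[rotated]) (auto simp: roots_def)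
qed

lemma finite_simple: "finite \<Delta>"
  using finite_roots simple_pos by (auto intro: finite_subset)

lemma simple_root: "d \<in> \<Delta> \<Longrightarrow> d \<in> roots W" "d \<in> \<Delta> \<Longrightarrow> pos d"
  using simple_pos by auto

lemma zero_notin_simple: "D \<subseteq> \<Delta> \<Longrightarrow> 0 \<notin> D"
  using simple_root root_neq_0 by blast

text \<open>Positive vectors cannot cancel in a nonnegative combination. This stands in for linear
  independence until that is available.\<close>

lemma pos_sum_or_zero:
  assumes "finite D" "\<And>d. d \<in> D \<Longrightarrow> pos d \<and> 0 \<le> c d"
  shows "(\<forall>d\<in>D. c d = 0) \<or> pos (\<Sum>d\<in>D. c d *\<^sub>R d)"
  using assms
proof (induction D)
  case (insert d D)
  have *: "pos d" "0 \<le> c d" using insert by auto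
  have IH: "(\<forall>d\<in>D. c d = 0) \<or> pos (\<Sum>d\<in>D. c d *\<^sub>R d)" using insert by auto
  show ?case
  proof (cases "c d = 0")
    case True
    then show ?thesis using IH insert by simp
  next
    case False
    then have "pos (c d *\<^sub>R d)" using * pos_scaleR by simp
    then show ?thesis using IH insert pos_add by auto
  qed
qed simp

lemma sum_simple_eq_0:
  assumes "D \<subseteq> \<Delta>" "\<And>d. d \<in> D \<Longrightarrow> 0 \<le> c d" "(\<Sum>d\<in>D. c d *\<^sub>R d) = 0" "d \<in> D"
  shows "c d = 0"
  using pos_sum_or_zero[of D c] assms finite_subset[OF assms(1) finite_simple] not_pos_0 simple_root(2)
  by auto

text \<open>Otherwise \<open>d\<close> could be eliminated from the expansion of every positive
  root, and the smaller set would contradict minimality.\<close>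

lemma simple_not_combination:
  assumes "d \<in> \<Delta>"
  shows "\<not> nonneg_combination (\<Delta> - {d}) d"
proof
  assume "nonneg_combination (\<Delta> - {d}) d"
  then obtain e where e: "\<forall>x\<in>\<Delta> - {d}. 0 \<le> e x" "d = (\<Sum>x\<in>\<Delta> - {d}. e x *\<^sub>R x)"
    by (auto simp: nonneg_combination_def)
  obtain a where a: "a \<in> roots W" "pos a" "\<not> nonneg_combination (\<Delta> - {d}) a"
    using simple_minimal[of "\<Delta> - {d}"] assms by blast
  obtain c where c: "\<forall>x\<in>\<Delta>. 0 \<le> c x" "a = (\<Sum>x\<in>\<Delta>. c x *\<^sub>R x)"
    using simple_comb[OF a(1,2)] by (auto simp: nonneg_combination_def)
  have "a = c d *\<^sub>R d + (\<Sum>x\<in>\<Delta> - {d}. c x *\<^sub>R x)"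
    using c(2) assms finite_simple by (simp add: sum.remove)
  also have "\<dots> = (\<Sum>x\<in>\<Delta> - {d}. (c d * e x + c x) *\<^sub>R x)"
    by (subst e(2)) (simp add: scaleR_sum_right scaleR_add_left sum.distrib)
  finally have "nonneg_combination (\<Delta> - {d}) a"
    unfolding nonneg_combination_def using c(1) e(1) assms
    by (intro exI[of _ "\<lambda>x. c d * e x + c x"]) auto
  then show False using a by simp
qed

text \<open>Independence with only one coefficient of unknown sign. If \<open>m\<close> is negative,
  solving for \<open>d\<close> contradicts \<open>simple_not_combination\<close>; otherwise nothing
  can cancel. It suits reflections, since the one in \<open>d\<close> alters only the coefficient of
  \<open>d\<close>.\<close>

lemma simple_relation:
  assumes d: "d \<in> \<Delta>" and c: "\<And>x. x \<in> \<Delta> - {d} \<Longrightarrow> 0 \<le> c x"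
    and eq: "m *\<^sub>R d + (\<Sum>x\<in>\<Delta> - {d}. c x *\<^sub>R x) = 0"
  shows "m = 0 \<and> (\<forall>x\<in>\<Delta> - {d}. c x = 0)"
proof (cases "m < 0")
  case True
  have "d = (\<Sum>x\<in>\<Delta> - {d}. (c x / - m) *\<^sub>R x)"
  proof -
    have "(- m) *\<^sub>R d = (\<Sum>x\<in>\<Delta> - {d}. c x *\<^sub>R x)"
      using eq by (simp add: neg_eq_iff_add_eq_0)
    then have "(1 / - m) *\<^sub>R (- m) *\<^sub>R d = (1 / - m) *\<^sub>R (\<Sum>x\<in>\<Delta> - {d}. c x *\<^sub>R x)"
      by simp
    then show ?thesis using True by (simp add: scaleR_sum_right)
  qed
  moreover have "\<forall>x\<in>\<Delta> - {d}. 0 \<le> c x / - m"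
    using True c by (auto intro!: divide_nonneg_neg simp: divide_nonpos_pos)
  ultimately have "nonneg_combination (\<Delta> - {d}) d"
    unfolding nonneg_combination_def by (intro exI[of _ "\<lambda>x. c x / - m"]) auto
  with simple_not_combination[OF d] show ?thesis by simp
next
  case False
  let ?c = "\<lambda>x. if x = d then m else c x"
  have "(\<Sum>x\<in>\<Delta>. ?c x *\<^sub>R x) = ?c d *\<^sub>R d + (\<Sum>x\<in>\<Delta> - {d}. ?c x *\<^sub>R x)"
    using d finite_simple by (simp add: sum.remove)
  also have "(\<Sum>x\<in>\<Delta> - {d}. ?c x *\<^sub>R x) = (\<Sum>x\<in>\<Delta> - {d}. c x *\<^sub>R x)"
    by (rule sum.cong) auto
  finally have "(\<Sum>x\<in>\<Delta>. ?c x *\<^sub>R x) = 0" using eq by simp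
  then have "?c x = 0" if "x \<in> \<Delta>" for x
    using sum_simple_eq_0[of \<Delta> ?c x] that c False by auto
  from this[OF d] this show ?thesis by (metis DiffE insertI1)
qed

text \<open>The reflection in \<open>d\<close> leaves the coefficients off \<open>d\<close> alone.
  If it turned \<open>b\<close> negative, these would be both nonnegative and nonpositive, so
  \<open>b\<close> would be a multiple of \<open>d\<close>, hence \<open>d\<close> itself.\<close>

lemma simple_reflection_pos:
  assumes d: "d \<in> \<Delta>" and b: "b \<in> roots W" "pos b" "b \<noteq> d"
  shows "pos (reflection d *v b)"
proof (rule ccontr)
  assume neg: "\<not> pos (reflection d *v b)"
  let ?k = "2 * (b \<bullet> d)"
  have r: "reflection d *v b = b - ?k *\<^sub>R d"
    using d simple_root reflection_root by auto
  have root: "reflection d *v b \<in> roots W"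
    using d b simple_root reflection_in_W W_root by blast
  then have neg': "pos (- (reflection d *v b))" "- (reflection d *v b) \<in> roots W"
    using neg not_pos_iff root_neq_0 minus_root by auto
  obtain c where c: "\<forall>x\<in>\<Delta>. 0 \<le> c x" "b = (\<Sum>x\<in>\<Delta>. c x *\<^sub>R x)"
    using simple_comb[OF b(1,2)] by (auto simp: nonneg_combination_def)
  obtain e where e: "\<forall>x\<in>\<Delta>. 0 \<le> e x" "- (reflection d *v b) = (\<Sum>x\<in>\<Delta>. e x *\<^sub>R x)"
    using simple_comb[OF neg'(2,1)] by (auto simp: nonneg_combination_def)
  \<comment> \<open>The expansions of \<open>b\<close> and of its negated image add up to
    \<open>?k *\<^sub>R d\<close>.\<close>
  have "(c d + e d - ?k) *\<^sub>R d + (\<Sum>x\<in>\<Delta> - {d}. (c x + e x) *\<^sub>R x)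
      = (\<Sum>x\<in>\<Delta>. (c x + e x) *\<^sub>R x) - ?k *\<^sub>R d"
    using d finite_simple by (simp add: sum.remove scaleR_diff_left)
  also have "\<dots> = 0"
    by (simp add: scaleR_add_left sum.distrib flip: c(2) e(2)) (simp add: r)
  finally have eq: "(c d + e d - ?k) *\<^sub>R d + (\<Sum>x\<in>\<Delta> - {d}. (c x + e x) *\<^sub>R x) = 0" .
  have "0 \<le> c x + e x" if "x \<in> \<Delta> - {d}" for x using c(1) e(1) that by simp
  from simple_relation[OF d this eq] have "\<forall>x\<in>\<Delta> - {d}. c x + e x = 0" by blast
  then have "\<forall>x\<in>\<Delta> - {d}. c x = 0"
    using c(1) e(1) by (metis DiffE add_nonneg_eq_0_iff)
  then have "b = c d *\<^sub>R d"
    using c(2) d finite_simple by (simp add: sum.remove)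
  moreover from this have "\<bar>c d\<bar> = 1"
    using norm_root[OF b(1)] norm_root[OF simple_root(1)[OF d]] by (metis mult.right_neutral norm_scaleR)
  ultimately show False
    using c(1) d b(3) by auto
qed

text \<open>The analogue of the Weyl vector for unit roots, without the customary factor 1/2. It
  lies inside the fundamental chamber, and its images under \<open>W\<close> serve as centres of the
  chambers.\<close>

definition rho :: "real^'n" where
  "rho = (\<Sum>b | b \<in> roots W \<and> pos b. b)"

text \<open>The reflection in \<open>d\<close> permutes the positive roots other than \<open>d\<close>, so it maps \<open>rho\<close> to
  \<open>rho - 2 *\<^sub>R d\<close>.\<close>

lemma rho_simple:
  assumes d: "d \<in> \<Delta>"
  shows "rho \<bullet> d = 1"
proof -
  let ?P = "{b. b \<in> roots W \<and> pos b}"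
  have fin: "finite ?P" using finite_roots by simp
  have dP: "d \<in> ?P" using d simple_root by auto
  have W: "reflection d \<in> W" using d simple_root reflection_in_W by auto
  have inv: "reflection d *v (reflection d *v x) = x" for x
    using reflection_reflection_vec root_neq_0 simple_root d by blast
  have mem: "reflection d *v b \<in> ?P - {d}" if "b \<in> ?P - {d}" for b
  proof -
    have "reflection d *v b \<noteq> d"
      using that inv[of b] reflection_self[of d] d simple_root not_pos_minus by auto
    then show ?thesis using that simple_reflection_pos[OF d] W_root[OF W] by auto
  qed
  have perm: "(\<Sum>b\<in>?P - {d}. reflection d *v b) = (\<Sum>b\<in>?P - {d}. b)"
    by (rule sum.reindex_bij_witness[of _ "\<lambda>b. reflection d *v b" "\<lambda>b. reflection d *v b"])
       (use inv mem in auto)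
  have "reflection d *v rho = reflection d *v d + (\<Sum>b\<in>?P - {d}. reflection d *v b)"
    unfolding rho_def using fin dP
    by (simp add: sum.remove[of _ d] matrix_vector_right_distrib
        linear_sum[OF matrix_vector_mul_linear] sum.distrib)
  also have "\<dots> = rho - 2 *\<^sub>R d"
    unfolding perm rho_def using fin dP d simple_root reflection_self
    by (simp add: sum.remove[of _ d] scaleR_2)
  finally have "(2 * (rho \<bullet> d)) *\<^sub>R d = 2 *\<^sub>R d"
    using d simple_root reflection_root by simp
  then show ?thesis
    using root_neq_0 simple_root d by auto
qed

text \<open>By \<open>rho_simple\<close> the inner product is the sum of the coefficients of
  \<open>a\<close> over the simple roots, which are nonnegative and not all zero.\<close>

lemma rho_pos:
  assumes "a \<in> roots W" "pos a"
  shows "0 < rho \<bullet> a"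
proof -
  obtain c where c: "\<forall>x\<in>\<Delta>. 0 \<le> c x" "a = (\<Sum>x\<in>\<Delta>. c x *\<^sub>R x)"
    using simple_comb[OF assms] by (auto simp: nonneg_combination_def)
  have "rho \<bullet> a = (\<Sum>x\<in>\<Delta>. c x)"
    unfolding c(2) by (simp add: inner_sum_right rho_simple)
  moreover have "\<exists>x\<in>\<Delta>. c x \<noteq> 0"
  proof (rule ccontr)
    assume "\<not> ?thesis"
    then have "a = 0" using c by simp
    then show False using assms not_pos_0 by simp
  qed
  ultimately show ?thesis
    using c(1) finite_simple by (metis sum_nonneg sum_nonneg_eq_0_iff order_le_less)
qed

text \<open>If the angle were acute, the reflection of \<open>d\<close> in \<open>e\<close> would be
  a positive root, and writing \<open>d\<close> as that root plus a positive multiple of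
  \<open>e\<close> gives a relation that \<open>simple_relation\<close> forbids.\<close>

lemma simple_obtuse:
  assumes d: "d \<in> \<Delta>" and e: "e \<in> \<Delta>" and ne: "d \<noteq> e"
  shows "d \<bullet> e \<le> 0"
proof (rule ccontr)
  assume "\<not> ?thesis"
  then have k: "0 < 2 * (d \<bullet> e)" by simp
  have r: "reflection e *v d = d - (2 * (d \<bullet> e)) *\<^sub>R e"
    using e simple_root reflection_root by auto
  have "pos (reflection e *v d)" "reflection e *v d \<in> roots W"
    using simple_reflection_pos[OF e] simple_root[OF d] ne W_root[OF reflection_in_W[OF simple_root(1)[OF e]]]
    by auto
  then obtain c where c: "\<forall>x\<in>\<Delta>. 0 \<le> c x" "reflection e *v d = (\<Sum>x\<in>\<Delta>. c x *\<^sub>R x)"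
    using simple_comb by (auto simp: nonneg_combination_def)
  let ?c = "\<lambda>x. if x = e then c x + 2 * (d \<bullet> e) else c x"
  have eD: "e \<in> \<Delta> - {d}" "finite (\<Delta> - {d})" using e ne finite_simple by auto
  have "(\<Sum>x\<in>\<Delta> - {d}. ?c x *\<^sub>R x) = (\<Sum>x\<in>\<Delta> - {d}. c x *\<^sub>R x) + (2 * (d \<bullet> e)) *\<^sub>R e"
    using eD by (simp add: sum.remove[of _ e] scaleR_add_left)
  moreover have "d = c d *\<^sub>R d + (\<Sum>x\<in>\<Delta> - {d}. c x *\<^sub>R x) + (2 * (d \<bullet> e)) *\<^sub>R e"
    using c(2) r d finite_simple by (simp add: sum.remove algebra_simps)
  ultimately have eq: "(c d - 1) *\<^sub>R d + (\<Sum>x\<in>\<Delta> - {d}. ?c x *\<^sub>R x) = 0"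
    by (simp add: scaleR_diff_left algebra_simps)
  have nonneg: "0 \<le> ?c x" if "x \<in> \<Delta> - {d}" for x
    using c(1) k that by (cases "x = e") (auto intro!: add_nonneg_nonneg)
  have "?c e = 0"
    using simple_relation[OF d nonneg eq] eD(1) by blast
  moreover have "0 \<le> c e" using c(1) e by blast
  ultimately show False using k by simp
qed

text \<open>Move the terms with nonpositive coefficients of a relation to the other side. Both sides
  equal one vector \<open>?z\<close>, and obtuse angles make its square nonpositive. So
  \<open>?z\<close> vanishes, and each side is a nonnegative combination equal to zero.\<close>

lemma simple_independent: "independent \<Delta>"
proof -
  have "u x = 0" if eq: "(\<Sum>v\<in>\<Delta>. u v *\<^sub>R v) = 0" and x: "x \<in> \<Delta>" for u x
  proof -
    define P where "P = {v \<in> \<Delta>. 0 < u v}"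
    define N where "N = \<Delta> - P"
    have sub: "P \<subseteq> \<Delta>" "N \<subseteq> \<Delta>" "finite P" "finite N" "P \<inter> N = {}" "P \<union> N = \<Delta>"
      using finite_simple by (auto simp: P_def N_def)
    have "(\<Sum>v\<in>P. u v *\<^sub>R v) + (\<Sum>v\<in>N. u v *\<^sub>R v) = 0"
      using eq sub sum.union_disjoint[of P N "\<lambda>v. u v *\<^sub>R v"] by simp
    then have eq2: "(\<Sum>v\<in>P. u v *\<^sub>R v) = (\<Sum>v\<in>N. (- u v) *\<^sub>R v)"
      by (simp add: sum_negf eq_neg_iff_add_eq_0)
    let ?z = "\<Sum>v\<in>P. u v *\<^sub>R v"
    have "?z \<bullet> ?z = (\<Sum>v\<in>P. u v *\<^sub>R v) \<bullet> (\<Sum>w\<in>N. (- u w) *\<^sub>R w)"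
      by (simp only: eq2[symmetric])
    also have "\<dots> = (\<Sum>v\<in>P. \<Sum>w\<in>N. u v * (- u w) * (v \<bullet> w))"
      unfolding inner_sum_left inner_sum_right
      by (subst sum.swap) (intro sum.cong, simp_all add: inner_commute)
    also have "\<dots> \<le> 0"
    proof (intro sum_nonpos mult_nonneg_nonpos)
      fix v w assume vw: "v \<in> P" "w \<in> N"
      then show "0 \<le> u v * - u w"
        by (auto simp: P_def N_def mult_nonneg_nonpos)
      show "v \<bullet> w \<le> 0"
        using vw sub by (intro simple_obtuse) auto
    qed
    finally have "?z = 0" by (simp add: inner_gt_zero_iff leD flip: not_less)
    then have "u v = 0" if "v \<in> P" for v
      using sum_simple_eq_0[of P u v] sub that by (auto simp: P_def)
    moreover have "- u v = 0" if "v \<in> N" for v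
    proof (rule sum_simple_eq_0[of N "\<lambda>v. - u v"])
      show "0 \<le> - u d" if "d \<in> N" for d using that by (auto simp: P_def N_def)
      show "(\<Sum>v\<in>N. (- u v) *\<^sub>R v) = 0" using \<open>?z = 0\<close> eq2 by simp
    qed (use sub that in auto)
    ultimately show ?thesis using x sub by (metis Un_iff neg_equal_0_iff_equal)
  qed
  then show ?thesis
    using independent_if_scalars_zero[OF finite_simple] by blast
qed

section \<open>Generation by simple reflections, exchange and free action\<close>

lemma simple_carrier: "D \<subseteq> \<Delta> \<Longrightarrow> reflection ` D \<subseteq> carrier GL"
  using zero_notin_simple[of D] by (auto intro!: invertible_reflection)

lemma generate_simple_subset: "D \<subseteq> \<Delta> \<Longrightarrow> generate GL (reflection ` D) \<subseteq> W"
  using simple_root reflection_in_W by (intro GL.generate_subgroup_incl[OF _ subgroup_W]) blast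

lemma refl_prod_in_W: "set ds \<subseteq> \<Delta> \<Longrightarrow> refl_prod ds \<in> W"
  using generate_simple_subset[of "set ds"] generate_reflections_iff[of "set ds"] zero_notin_simple
  by blast

text \<open>Among the positive roots in an orbit, one of least inner product with \<open>rho\<close> is simple.\<close>

lemma pos_root_conj_simple:
  assumes "a \<in> roots W" "pos a"
  shows "\<exists>ds. set ds \<subseteq> \<Delta> \<and> refl_prod ds *v a \<in> \<Delta>"
proof -
  define Q where "Q = {b. (\<exists>ds. set ds \<subseteq> \<Delta> \<and> b = refl_prod ds *v a) \<and> b \<in> roots W \<and> pos b}"
  have "a = refl_prod [] *v a" by simp
  then have "a \<in> Q" unfolding Q_def using assms
    by (metis (mono_tags, lifting) empty_set empty_subsetI mem_Collect_eq)
  moreover have "finite Q"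
    using finite_roots by (rule finite_subset[rotated]) (auto simp: Q_def)
  ultimately obtain b where b: "b \<in> Q" "\<And>x. x \<in> Q \<Longrightarrow> rho \<bullet> b \<le> rho \<bullet> x"
    by (metis arg_min_if_finite(1) arg_min_least empty_iff)
  then obtain ds where ds: "set ds \<subseteq> \<Delta>" "b = refl_prod ds *v a" and bW: "b \<in> roots W" "pos b"
    by (auto simp: Q_def)
  obtain c where c: "\<forall>x\<in>\<Delta>. 0 \<le> c x" "b = (\<Sum>x\<in>\<Delta>. c x *\<^sub>R x)"
    using simple_comb[OF bW] by (auto simp: nonneg_combination_def)
  have "b \<bullet> b = (\<Sum>x\<in>\<Delta>. c x * (b \<bullet> x))"
    by (subst (2) c(2)) (simp add: inner_sum_right)
  moreover have "b \<bullet> b = 1" using norm_root[OF bW(1)] by (simp add: dot_square_norm)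
  ultimately have "\<not> (\<Sum>x\<in>\<Delta>. c x * (b \<bullet> x)) \<le> 0" by simp
  \<comment> \<open>As \<open>b\<close> is a unit vector, some term of this expansion of
    \<open>b \<bullet> b\<close> is positive, which yields a simple \<open>d\<close> with
    \<open>b \<bullet> d\<close> positive.\<close>
  then obtain d where d: "d \<in> \<Delta>" "\<not> c d * (b \<bullet> d) \<le> 0"
    using sum_nonpos[of \<Delta> "\<lambda>x. c x * (b \<bullet> x)"] by blast
  then have bd: "b \<bullet> d > 0"
    using c(1) by (smt (verit, best) mult_nonneg_nonpos)
  have "b = d"
  proof (rule ccontr)
    \<comment> \<open>Reflecting in \<open>d\<close> would stay in \<open>Q\<close> but lower the
      inner product with \<open>rho\<close> by \<open>2 * (b \<bullet> d)\<close>.\<close>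
    assume "b \<noteq> d"
    let ?b = "reflection d *v b"
    have "?b = refl_prod (d # ds) *v a"
      using ds(2) by (simp add: matrix_vector_mul_assoc)
    moreover have "?b \<in> roots W" "pos ?b"
      using \<open>b \<noteq> d\<close> d(1) bW simple_reflection_pos simple_root reflection_in_W W_root by blast+
    ultimately have "?b \<in> Q"
      unfolding Q_def using ds(1) d(1) by (metis (mono_tags, lifting) insert_subset list.simps(15) mem_Collect_eq)
    then have "rho \<bullet> b \<le> rho \<bullet> ?b" using b by blast
    also have "\<dots> = rho \<bullet> b - 2 * (b \<bullet> d)"
      using d(1) simple_root(1) reflection_root rho_simple by (simp add: inner_diff_right)
    finally show False using bd by simp
  qed
  then show ?thesis using ds d by auto
qed

text \<open>Every positive root is carried to a simple one by a word in simple reflections, so its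
  reflection is a conjugate of a simple reflection by that word.\<close>

lemma W_generated: "W = generate GL (reflection ` \<Delta>)"
proof (rule antisym)
  let ?G = "generate GL (reflection ` \<Delta>)"
  show "?G \<subseteq> W" using generate_simple_subset by simp
  have carr: "reflection ` \<Delta> \<subseteq> carrier GL"
    by (rule simple_carrier) simp
  obtain R where R: "R \<subseteq> reflection ` {a. a \<noteq> 0}" "W = generate GL R"
    using frg by (auto simp: finite_reflection_group_def)
  have pos_case: "reflection a \<in> ?G" if a: "a \<in> roots W" "pos a" for a
  proof -
    obtain ds where ds: "set ds \<subseteq> \<Delta>" "refl_prod ds *v a \<in> \<Delta>"
      using pos_root_conj_simple[OF a] by blast
    define g where "g = refl_prod ds"
    have g: "g \<in> W" "g \<in> ?G"
      using ds(1) refl_prod_in_W generate_reflections_iff[of \<Delta>] zero_notin_simple by (auto simp: g_def)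
    have gT: "transpose g \<in> ?G"
      using GL.generate_m_inv_closed[OF carr g(2)] inv_W_eq[OF g(1)] by simp
    have "reflection (g *v a) \<in> ?G"
      using ds(2) by (auto simp: g_def intro: generate.incl)
    then have "transpose g \<otimes>\<^bsub>GL\<^esub> reflection (g *v a) \<otimes>\<^bsub>GL\<^esub> g \<in> ?G"
      using gT g by (intro generate.eng)
    also have "transpose g \<otimes>\<^bsub>GL\<^esub> reflection (g *v a) \<otimes>\<^bsub>GL\<^esub> g = reflection a"
      using g(1) reflection_conj[of g a] mult_transpose_W[of g]
      by simp (metis matrix_mul_assoc matrix_mul_lid matrix_mul_rid)
    finally show ?thesis .
  qed
  have "R \<subseteq> ?G"
  proof
    fix r assume r: "r \<in> R"
    then obtain a where a: "a \<noteq> 0" "r = reflection a" using R by auto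
    \<comment> \<open>The given generators may have normals of any length and sign, while roots are
      unit vectors.\<close>
    define b where "b = a /\<^sub>R norm a"
    have "reflection b = r"
      using a reflection_scaleR[of "inverse (norm a)" a] by (simp add: b_def)
    moreover have "r \<in> W" using r R by (auto intro: generate.incl)
    ultimately have b: "b \<in> roots W" using a by (simp add: roots_def b_def)
    then have "reflection b \<in> ?G"
      using pos_case[of b] pos_case[of "- b"] pos_cases[of b] root_neq_0 minus_root
      by (auto simp: reflection_minus)
    then show "r \<in> ?G" using \<open>reflection b = r\<close> by simp
  qed
  then show "W \<subseteq> ?G"
    unfolding R(2) by (intro GL.generate_subgroup_incl GL.generate_is_subgroup carr)
qed

text \<open>The strong exchange condition. Let the letters of \<open>ds\<close> act on
  \<open>b\<close> one after another. Where the sign first changes, the current root must be that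
  letter, by \<open>simple_reflection_pos\<close>, and multiplication by \<open>reflection b\<close>
  deletes it.\<close>

lemma exchange:
  assumes "b \<in> roots W" "pos b" "set ds \<subseteq> \<Delta>" "\<not> pos (transpose (refl_prod ds) *v b)"
  shows "\<exists>ds'. set ds' \<subseteq> \<Delta> \<and> length ds' < length ds \<and> reflection b ** refl_prod ds = refl_prod ds'"
  using assms
proof (induction ds arbitrary: b)
  case Nil
  then show ?case by (simp add: transpose_mat)
next
  case (Cons e es)
  have e: "e \<in> \<Delta>" "set es \<subseteq> \<Delta>" "e \<in> roots W" "e \<noteq> 0"
    using Cons simple_root root_neq_0 by auto
  have ee: "reflection e ** reflection e = mat 1" using e reflection_involution by blast
  show ?case
  proof (cases "b = e")
    case True
    then have "reflection b ** refl_prod (e # es) = refl_prod es"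
      using ee by (simp add: matrix_mul_assoc)
    then show ?thesis using e by (intro exI[of _ es]) auto
  next
    case False
    let ?b = "reflection e *v b"
    have "transpose (refl_prod (e # es)) *v b = transpose (refl_prod es) *v ?b"
      by (simp add: matrix_transpose_mul transpose_reflection matrix_vector_mul_assoc)
    moreover have "pos ?b" "?b \<in> roots W"
      using False e Cons.prems simple_reflection_pos reflection_in_W W_root by blast+
    ultimately obtain ds' where ds': "set ds' \<subseteq> \<Delta>" "length ds' < length es"
        "reflection ?b ** refl_prod es = refl_prod ds'"
      using Cons.IH[of ?b] Cons.prems e by auto
    \<comment> \<open>Conjugation moves the reflection past the letter \<open>e\<close>, turning
      \<open>b\<close> into \<open>?b\<close>.\<close>
    have "reflection ?b = reflection e ** reflection b ** reflection e"
      using reflection_conj[OF reflection_in_W[OF e(3)]] by (simp add: transpose_reflection)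
    then have "reflection b ** reflection e = reflection e ** reflection ?b"
      using ee by (metis matrix_mul_assoc matrix_mul_lid)
    then have "reflection b ** refl_prod (e # es) = refl_prod (e # ds')"
      using ds'(3) by (simp add: matrix_mul_assoc) (metis matrix_mul_assoc)
    then show ?thesis using ds' e by (intro exI[of _ "e # ds'"]) auto
  qed
qed

text \<open>Take a shortest word for \<open>u\<close>. If it began with \<open>d\<close>, then
  positivity of \<open>transpose u *v d\<close> would make the remaining word turn \<open>d\<close>
  negative, and \<open>exchange\<close> would shorten the word.\<close>

lemma free_action:
  assumes u: "u \<in> W" and pres: "\<And>b. b \<in> \<Delta> \<Longrightarrow> pos (transpose u *v b)"
  shows "u = mat 1"
proof -
  define P where "P ds \<longleftrightarrow> set ds \<subseteq> \<Delta> \<and> u = refl_prod ds" for ds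
  have "\<exists>ds. P ds"
  proof -
    have "u \<in> generate GL (reflection ` \<Delta>)"
      using u by (subst (asm) W_generated)
    then show ?thesis
      unfolding P_def using generate_reflections_iff[OF zero_notin_simple[OF order_refl], of u] by auto
  qed
  then have "\<exists>ds. P ds \<and> (\<forall>ds'. P ds' \<longrightarrow> length ds \<le> length ds')"
    using ex_has_least_nat[of P _ length] by auto
  then obtain ds where ds: "set ds \<subseteq> \<Delta>" "u = refl_prod ds"
    and min: "\<And>ds'. set ds' \<subseteq> \<Delta> \<Longrightarrow> u = refl_prod ds' \<Longrightarrow> length ds \<le> length ds'"
    by (auto simp: P_def)
  show ?thesis
  proof (cases ds)
    case Nil
    then show ?thesis using ds by simp
  next
    case (Cons d es)
    have d: "d \<in> \<Delta>" "d \<in> roots W" "pos d" "set es \<subseteq> \<Delta>"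
      using ds Cons simple_root by auto
    have "transpose u *v d = transpose (refl_prod es) *v (reflection d *v d)"
      using ds(2) Cons by (simp add: matrix_transpose_mul transpose_reflection matrix_vector_mul_assoc)
    also have "\<dots> = - (transpose (refl_prod es) *v d)"
      by (simp add: reflection_self[OF d(2)] linear_neg[OF matrix_vector_mul_linear])
    finally have "\<not> pos (transpose (refl_prod es) *v d)"
      using pres[OF d(1)] not_pos_minus by force
    then obtain ds' where "set ds' \<subseteq> \<Delta>" "length ds' < length es"
        "reflection d ** refl_prod es = refl_prod ds'"
      using exchange d by blast
    then show ?thesis using min[of ds'] ds Cons by auto
  qed
qed

text \<open>The sign is followed as in \<open>exchange\<close>, but here the letter at which it
  changes is recorded: \<open>b\<close> is an image of that letter under the letters before it. So a
  hyperplane separating two chambers of a parabolic subgroup belongs to that subgroup.\<close>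

lemma separating_root:
  assumes D: "D \<subseteq> \<Delta>" and u: "u \<in> generate GL (reflection ` D)"
    and b: "b \<in> roots W" "pos b" "\<not> pos (transpose u *v b)"
  shows "\<exists>v\<in>generate GL (reflection ` D). \<exists>d\<in>D. b = v *v d"
proof -
  obtain ds where ds: "set ds \<subseteq> D" "u = refl_prod ds"
    using u generate_reflections_iff[OF zero_notin_simple[OF D], of u] by auto
  from ds(1) b have "\<exists>es. set es \<subseteq> D \<and> (\<exists>d\<in>D. b = refl_prod es *v d)"
    unfolding ds(2)
  proof (induction ds arbitrary: b)
    case Nil
    then show ?case by (simp add: transpose_mat)
  next
    case (Cons e es)
    have e: "e \<in> D" "e \<in> \<Delta>" "set es \<subseteq> D" "e \<in> roots W" "e \<noteq> 0"
      using Cons.prems D simple_root(1) zero_notin_simple[OF D] by auto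
    show ?case
    proof (cases "b = e")
      case True
      then show ?thesis using e by (intro exI[of _ "[]"]) auto
    next
      case False
      let ?b = "reflection e *v b"
      have "transpose (refl_prod (e # es)) *v b = transpose (refl_prod es) *v ?b"
        by (simp add: matrix_transpose_mul transpose_reflection matrix_vector_mul_assoc)
      moreover have "pos ?b" "?b \<in> roots W"
        using False e Cons.prems simple_reflection_pos reflection_in_W W_root by blast+
      ultimately obtain fs d where fs: "set fs \<subseteq> D" "d \<in> D" "?b = refl_prod fs *v d"
        using Cons.IH[of ?b] Cons.prems e by auto
      have "b = reflection e *v ?b"
        using reflection_reflection_vec[OF e(5)] by simp
      then have "b = refl_prod (e # fs) *v d"
        using fs(3) by (simp add: matrix_vector_mul_assoc)
      then show ?thesis using fs e by (intro exI[of _ "e # fs"]) auto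
    qed
  qed
  then obtain es d where "set es \<subseteq> D" "d \<in> D" "b = refl_prod es *v d" by auto
  then show ?thesis
    using generate_reflections_iff[OF zero_notin_simple[OF D], of "refl_prod es"] by auto
qed

lemma separating_reflection:
  assumes D: "D \<subseteq> \<Delta>" and u: "u \<in> generate GL (reflection ` D)"
    and b: "b \<in> roots W" "pos b" "\<not> pos (transpose u *v b)"
  shows "reflection b \<in> generate GL (reflection ` D)"
proof -
  let ?G = "generate GL (reflection ` D)"
  obtain v d where v: "v \<in> ?G" "d \<in> D" "b = v *v d"
    using separating_root[OF assms] by auto
  have carr: "reflection ` D \<subseteq> carrier GL"
    using D by (rule simple_carrier)
  have vW: "v \<in> W" using v(1) generate_simple_subset[OF D] by auto
  then have "transpose v \<in> ?G"
    using GL.generate_m_inv_closed[OF carr v(1)] inv_W_eq[OF vW] by simp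
  then have "v \<otimes>\<^bsub>GL\<^esub> reflection d \<otimes>\<^bsub>GL\<^esub> transpose v \<in> ?G"
    using v by (intro generate.eng) (auto intro: generate.incl)
  then show ?thesis using v(3) reflection_conj[OF vW] by simp
qed

lemma generate_simple_span:
  assumes D: "D \<subseteq> \<Delta>" and u: "u \<in> generate GL (reflection ` D)" and x: "x \<in> span D"
  shows "u *v x \<in> span D"
proof -
  obtain ds where ds: "set ds \<subseteq> D" "u = refl_prod ds"
    using u generate_reflections_iff[OF zero_notin_simple[OF D], of u] by auto
  from ds(1) show ?thesis unfolding ds(2)
    by (induction ds)
       (auto simp: x matrix_vector_mul_assoc[symmetric] reflection_vec intro!: span_diff span_scale
         intro: span_base)
qed

text \<open>A simple root turned negative by \<open>u\<close> is an image of an element of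
  \<open>D1\<close>, so it lies in the span of \<open>D1\<close>, and likewise in that of
  \<open>D2\<close>. By independence it would belong to both sets.\<close>

lemma generate_simple_disjoint:
  assumes D: "D1 \<subseteq> \<Delta>" "D2 \<subseteq> \<Delta>" "D1 \<inter> D2 = {}"
    and u: "u \<in> generate GL (reflection ` D1)" "u \<in> generate GL (reflection ` D2)"
  shows "u = mat 1"
proof (rule free_action)
  show "u \<in> W" using u generate_simple_subset D by blast
  fix b assume b: "b \<in> \<Delta>"
  show "pos (transpose u *v b)"
  proof (rule ccontr)
    assume neg: "\<not> pos (transpose u *v b)"
    have mem: "b \<in> D" if D: "D \<subseteq> \<Delta>" "u \<in> generate GL (reflection ` D)" for D
    proof -
      obtain v d where v: "v \<in> generate GL (reflection ` D)" "d \<in> D" "b = v *v d"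
        using separating_root[OF D simple_root[OF b] neg] by auto
      then have "b \<in> span D" using generate_simple_span[OF D(1)] span_base by metis
      moreover have "b \<notin> span (\<Delta> - {b})"
        using simple_independent b by (simp add: dependent_def)
      ultimately show "b \<in> D" using D(1) span_mono[of D "\<Delta> - {b}"] by blast
    qed
    show False using mem[OF D(1) u(1)] mem[OF D(2) u(2)] D(3) by blast
  qed
qed

text \<open>For a root \<open>a\<close> these are the chambers on the positive side of its
  hyperplane: \<open>(w *v rho) \<bullet> a\<close> equals
  \<open>rho \<bullet> (transpose w *v a)\<close>, whose sign is that of the root
  \<open>transpose w *v a\<close>.\<close>

definition side :: "real^'n \<Rightarrow> (real^'n^'n) set" where
  "side a = {w \<in> W. pos (transpose w *v a)}"

lemma side_minus:
  assumes "a \<in> roots W"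
  shows "side (- a) = W - side a"
proof -
  have "pos (transpose w *v (- a)) \<longleftrightarrow> \<not> pos (transpose w *v a)" if "w \<in> W" for w
    using not_pos_iff[OF root_neq_0[OF W_root[OF transpose_W[OF that] assms]]]
    by (simp add: linear_neg[OF matrix_vector_mul_linear])
  then show ?thesis by (auto simp: side_def)
qed

lemma reflection_side:
  assumes "a \<in> roots W" "w \<in> W"
  shows "reflection a ** w \<in> side a \<longleftrightarrow> w \<notin> side a"
proof -
  have "transpose (reflection a ** w) *v a = transpose w *v (- a)"
    by (simp add: matrix_transpose_mul transpose_reflection reflection_self[OF assms(1)]
        flip: matrix_vector_mul_assoc)
  then have "reflection a ** w \<in> side a \<longleftrightarrow> w \<in> side (- a)"
    using assms mult_W reflection_in_W by (auto simp: side_def)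
  then show ?thesis using side_minus assms by simp
qed

text \<open>The walls of the chamber of \<open>w0\<close> are the hyperplanes of
  \<open>w0 *v b\<close> with \<open>b\<close> simple. If none of them separated it from
  \<open>w\<close>, \<open>free_action\<close> would identify the two.\<close>

lemma sides_separate:
  assumes w0: "w0 \<in> W" and w: "w \<in> W" and ne: "w \<noteq> w0"
  shows "\<exists>a\<in>roots W. w0 \<in> side a \<and> w \<notin> side a"
proof -
  let ?u = "transpose w0 ** w"
  have u: "?u \<in> W" using w0 w mult_W transpose_W by auto
  have "?u \<noteq> mat 1"
    using ne mult_transpose_W(1)[OF w0] by (metis matrix_mul_assoc matrix_mul_lid matrix_mul_rid)
  then obtain b where b: "b \<in> \<Delta>" "\<not> pos (transpose ?u *v b)"
    using free_action[OF u] by blast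
  have "transpose w0 *v (w0 *v b) = b" using w0 by simp
  moreover have "transpose ?u *v b = transpose w *v (w0 *v b)"
    by (simp add: matrix_transpose_mul matrix_vector_mul_assoc)
  moreover have "w0 *v b \<in> roots W" using b w0 W_root simple_root by blast
  ultimately show ?thesis
    using b simple_root(2)[OF b(1)] w0 by (intro bexI[of _ "w0 *v b"]) (auto simp: side_def)
qed

text \<open>The reflection subtracts twice the product of the inner products of \<open>a\<close>
  with the two centres, and these have opposite signs.\<close>

lemma reflection_increases_height:
  assumes a: "a \<in> roots W" and w0: "w0 \<in> side a" and w: "w \<in> W - side a"
  shows "(w *v rho) \<bullet> (w0 *v rho) < ((reflection a ** w) *v rho) \<bullet> (w0 *v rho)"
proof -
  have *: "0 < (v *v rho) \<bullet> b" if "b \<in> roots W" "v \<in> side b" for v b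
  proof -
    have "(v *v rho) \<bullet> b = rho \<bullet> (transpose v *v b)"
      by (metis inner_transpose inner_commute)
    then show ?thesis
      using that rho_pos[of "transpose v *v b"] W_root transpose_W by (auto simp: side_def)
  qed
  have "0 < (w *v rho) \<bullet> (- a)"
    using w side_minus[OF a] minus_root[OF a] by (intro *) auto
  moreover have "0 < (w0 *v rho) \<bullet> a" using * a w0 by blast
  ultimately have "((w *v rho) \<bullet> a) * (a \<bullet> (w0 *v rho)) < 0"
    by (simp add: mult_neg_pos inner_commute)
  moreover have "((reflection a ** w) *v rho) \<bullet> (w0 *v rho)
      = (w *v rho) \<bullet> (w0 *v rho) - 2 * (((w *v rho) \<bullet> a) * (a \<bullet> (w0 *v rho)))"
    by (simp add: reflection_root[OF a] inner_diff_left flip: matrix_vector_mul_assoc)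
  ultimately show ?thesis by linarith
qed

text \<open>Pulled back by \<open>w\<close>, the root separates the identity from \<open>u\<close>,
  so its reflection lies in the subgroup by \<open>separating_reflection\<close>; conjugating back
  gives the claim.\<close>

lemma reflection_coset:
  assumes D: "D \<subseteq> \<Delta>" and a: "a \<in> roots W" and w: "w \<in> side a"
    and u: "u \<in> generate GL (reflection ` D)" "w ** u \<notin> side a"
  shows "\<exists>v\<in>generate GL (reflection ` D). reflection a ** w = w ** v"
proof
  have wW: "w \<in> W" using w by (simp add: side_def)
  have uW: "u \<in> W" using u generate_simple_subset[OF D] by auto
  let ?b = "transpose w *v a"
  have b: "?b \<in> roots W" "pos ?b"
    using w a W_root transpose_W by (auto simp: side_def)
  have "\<not> pos (transpose u *v ?b)"
    using u(2) mult_W[OF wW uW] by (simp add: side_def matrix_transpose_mul matrix_vector_mul_assoc)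
  then show "reflection ?b \<in> generate GL (reflection ` D)"
    using separating_reflection D u b by blast
  have "w ** reflection ?b = (w ** transpose w) ** reflection a ** w"
    using reflection_conj[OF transpose_W[OF wW], of a] by (simp add: matrix_mul_assoc)
  then show "reflection a ** w = w ** reflection ?b"
    using mult_transpose_W(1)[OF wW] by simp
qed

end

section \<open>Percolation\<close>

definition fold_along :: "'e set \<Rightarrow> ('e \<Rightarrow> 'e) \<Rightarrow> ('e \<Rightarrow> 'x) \<Rightarrow> 'e \<Rightarrow> 'x" where
  "fold_along P \<tau> \<psi> = (\<lambda>e. if e \<in> P then \<psi> e else \<psi> (\<tau> e))"

text \<open>A fold \<open>(P, \<tau>)\<close> copies the half \<open>P\<close> of \<open>E\<close> onto the other half along the involution \<open>\<tau>\<close>.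
  The height condition lets the colour of \<open>e0\<close> percolate through \<open>E\<close>, in order of
  decreasing height.\<close>

locale percolating_folds =
  fixes E :: "'e set" and T :: "('e set \<times> ('e \<Rightarrow> 'e)) set" and h :: "'e \<Rightarrow> 'e \<Rightarrow> real"
  assumes finite_E: "finite E"
    and fold_half: "(P, \<tau>) \<in> T \<Longrightarrow> P \<subseteq> E"
    and fold_compl: "(P, \<tau>) \<in> T \<Longrightarrow> (E - P, \<tau>) \<in> T"
    and fold_swap: "(P, \<tau>) \<in> T \<Longrightarrow> e \<in> E - P \<Longrightarrow> \<tau> e \<in> P"
    and fold_inv: "(P, \<tau>) \<in> T \<Longrightarrow> e \<in> E \<Longrightarrow> \<tau> (\<tau> e) = e"
    and separate: "e0 \<in> E \<Longrightarrow> e \<in> E \<Longrightarrow> e \<noteq> e0 \<Longrightarrow> \<exists>(P, \<tau>)\<in>T. e0 \<in> P \<and> e \<notin> P"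
    and higher: "(P, \<tau>) \<in> T \<Longrightarrow> e0 \<in> P \<Longrightarrow> e \<in> E - P \<Longrightarrow> h e0 e < h e0 (\<tau> e)"
begin

lemma fold_bij: "(P, \<tau>) \<in> T \<Longrightarrow> bij_betw \<tau> (E - P) P"
  using fold_half[of P \<tau>] fold_compl[of P \<tau>] fold_swap[of P \<tau>] fold_swap[of "E - P" \<tau>] fold_inv[of P \<tau>]
  by (intro bij_betw_byWitness[where f' = \<tau>]) (auto simp: subset_iff)

lemma fold_along_image:
  assumes "\<phi> ` E \<subseteq> Y" "(P, \<tau>) \<in> T"
  shows "fold_along P \<tau> \<phi> ` E \<subseteq> Y"
  using assms fold_swap[OF assms(2)] fold_half[OF assms(2)]
  by (auto simp: fold_along_def image_subset_iff)

text \<open>The colour of \<open>e0\<close> fills ever larger sets \<open>U\<close> that are closed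
  under going higher. To add a lowest element \<open>x\<close>, fold along a half with
  \<open>e0\<close> but without \<open>x\<close>. An element of \<open>insert x U\<close> outside
  the half copies its mirror image, which is higher, hence in the closed set, and is not
  \<open>x\<close>, hence already coloured.\<close>

lemma percolation:
  assumes e0: "e0 \<in> E"
    and start: "Q \<psi>"
    and step: "\<And>\<psi> P \<tau>. Q \<psi> \<Longrightarrow> (P, \<tau>) \<in> T \<Longrightarrow> e0 \<in> P \<Longrightarrow> Q (fold_along P \<tau> \<psi>)"
  shows "\<exists>\<psi>'. Q \<psi>' \<and> (\<forall>e\<in>E. \<psi>' e = \<psi> e0)"
proof -
  let ?c = "\<psi> e0"
  have "U \<subseteq> E \<Longrightarrow> (\<And>x y. x \<in> U \<Longrightarrow> y \<in> E \<Longrightarrow> h e0 x < h e0 y \<Longrightarrow> y \<in> U) \<Longrightarrow>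
      \<exists>\<psi>'. Q \<psi>' \<and> \<psi>' e0 = ?c \<and> (\<forall>e\<in>U. \<psi>' e = ?c)" if "finite U" for U
    using that
  \<comment> \<open>Ranking by negated height inserts the elements from high to low.\<close>
  proof (induction U rule: finite_ranking_induct[where f = "\<lambda>e. - h e0 e"])
    case empty
    then show ?case using start by auto
  next
    case (insert x U)
    have "\<exists>\<psi>'. Q \<psi>' \<and> \<psi>' e0 = ?c \<and> (\<forall>e\<in>U. \<psi>' e = ?c)"
    proof (rule insert.IH)
      fix y z assume yz: "y \<in> U" "z \<in> E" "h e0 y < h e0 z"
      then have "z \<in> insert x U" using insert.prems(2)[of y z] by auto
      moreover have "h e0 x \<le> h e0 y" using insert.hyps(2)[OF yz(1)] by simp
      ultimately show "z \<in> U" using yz by auto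
    qed (use insert in auto)
    then obtain \<psi>' where \<psi>': "Q \<psi>'" "\<psi>' e0 = ?c" "\<forall>e\<in>U. \<psi>' e = ?c"
      by auto
    show ?case
    proof (cases "x = e0")
      case True
      then show ?thesis using \<psi>' by auto
    next
      case False
      then obtain P \<tau> where P: "(P, \<tau>) \<in> T" "e0 \<in> P" "x \<notin> P"
        using separate[OF e0, of x] insert.prems(1) by auto
      have "fold_along P \<tau> \<psi>' e = ?c" if e: "e \<in> insert x U" for e
      proof (cases "e \<in> P")
        case True
        then show ?thesis using \<psi>' P(3) e by (auto simp: fold_along_def)
      next
        case False
        then have eE: "e \<in> E - P" using e insert.prems(1) by auto
        have lt: "h e0 e < h e0 (\<tau> e)" and tP: "\<tau> e \<in> P"
          using higher[OF P(1,2) eE] fold_swap[OF P(1) eE] by auto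
        then have "\<tau> e \<in> insert x U"
          using insert.prems(2)[OF e _ lt] fold_half[OF P(1)] by auto
        with tP P(3) have "\<tau> e \<in> U" by auto
        then show ?thesis using False \<psi>' by (auto simp: fold_along_def)
      qed
      then show ?thesis
        using step[OF \<psi>'(1) P(1,2)] \<psi>' P(2) by (intro exI[of _ "fold_along P \<tau> \<psi>'"]) (auto simp: fold_along_def)
    qed
  qed
  from this[OF finite_E] show ?thesis by auto
qed

text \<open>One fold doubles every factor from \<open>P\<close>, the other every factor from the
  complement. Hence the normalising product is compatible with the Cauchy-Schwarz bound.\<close>

lemma prod_folds:
  fixes N :: "'x \<Rightarrow> real"
  assumes "(P, \<tau>) \<in> T"
  shows "(\<Prod>e\<in>E. N (fold_along P \<tau> \<psi> e)) * (\<Prod>e\<in>E. N (fold_along (E - P) \<tau> \<psi> e))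
    = (\<Prod>e\<in>E. N (\<psi> e))\<^sup>2"
proof -
  have half: "(\<Prod>e\<in>E. N (fold_along R \<tau> \<psi> e)) = (\<Prod>e\<in>R. N (\<psi> e))\<^sup>2" if R: "(R, \<tau>) \<in> T" for R
  proof -
    have "(\<Prod>e\<in>E. N (fold_along R \<tau> \<psi> e))
        = (\<Prod>e\<in>E - R. N (fold_along R \<tau> \<psi> e)) * (\<Prod>e\<in>R. N (fold_along R \<tau> \<psi> e))"
      using finite_E fold_half[OF R] by (rule prod.subset_diff[rotated])
    also have "(\<Prod>e\<in>E - R. N (fold_along R \<tau> \<psi> e)) = (\<Prod>e\<in>E - R. N (\<psi> (\<tau> e)))"
      by (rule prod.cong) (auto simp: fold_along_def)
    also have "\<dots> = (\<Prod>e\<in>R. N (\<psi> e))"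
      by (rule prod.reindex_bij_betw[OF fold_bij[OF R]])
    also have "(\<Prod>e\<in>R. N (fold_along R \<tau> \<psi> e)) = (\<Prod>e\<in>R. N (\<psi> e))"
      by (rule prod.cong) (auto simp: fold_along_def)
    finally show ?thesis by (simp add: power2_eq_square)
  qed
  have "(\<Prod>e\<in>E. N (\<psi> e)) = (\<Prod>e\<in>E - P. N (\<psi> e)) * (\<Prod>e\<in>P. N (\<psi> e))"
    using finite_E fold_half[OF assms] by (rule prod.subset_diff[rotated])
  then show ?thesis
    using half[OF assms] half[OF fold_compl[OF assms]] by (simp add: power_mult_distrib)
qed

text \<open>If all \<open>G (\<lambda>_. \<psi> e)\<close> are positive, normalise them to 1: folding a colouring that maximises
  \<open>G\<close> gives another maximiser, and percolation leads to a constant one. If one of them vanishes,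
  percolation to that colour shows that \<open>G \<psi>\<close> vanishes too.\<close>

lemma hoelder:
  fixes G :: "('e \<Rightarrow> 'x) \<Rightarrow> real"
  assumes G_cong: "\<And>\<phi> \<psi>. (\<And>e. e \<in> E \<Longrightarrow> \<phi> e = \<psi> e) \<Longrightarrow> G \<phi> = G \<psi>"
    and G_nonneg: "\<And>\<psi>. 0 \<le> G \<psi>"
    and G_fold: "\<And>\<psi> P \<tau>. \<psi> ` E \<subseteq> X \<Longrightarrow> (P, \<tau>) \<in> T \<Longrightarrow>
      (G \<psi>)\<^sup>2 \<le> G (fold_along P \<tau> \<psi>) * G (fold_along (E - P) \<tau> \<psi>)"
    and \<psi>: "\<psi> ` E \<subseteq> X"
  shows "G \<psi> ^ card E \<le> (\<Prod>e\<in>E. G (\<lambda>_. \<psi> e))"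
proof (cases "\<exists>e\<in>E. G (\<lambda>_. \<psi> e) = 0")
  case True
  obtain e0 where e0: "e0 \<in> E" "G (\<lambda>_. \<psi> e0) = 0" using True by auto
  have "G \<psi> = 0"
  proof (rule ccontr)
    assume "G \<psi> \<noteq> 0"
    define Q where "Q \<phi> \<longleftrightarrow> \<phi> ` E \<subseteq> X \<and> G \<phi> \<noteq> 0" for \<phi>
    have "\<exists>\<phi>. Q \<phi> \<and> (\<forall>e\<in>E. \<phi> e = \<psi> e0)"
    proof (rule percolation[OF e0(1)])
      show "Q \<psi>" using \<psi> \<open>G \<psi> \<noteq> 0\<close> by (simp add: Q_def)
      fix \<phi> P \<tau> assume Q: "Q \<phi>" and P: "(P, \<tau>) \<in> T"
      have "0 < (G \<phi>)\<^sup>2" using Q by (simp add: Q_def)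
      with G_fold[OF _ P, of \<phi>] Q have "G (fold_along P \<tau> \<phi>) \<noteq> 0"
        by (auto simp: Q_def)
      then show "Q (fold_along P \<tau> \<phi>)"
        using Q fold_along_image[OF _ P] by (auto simp: Q_def)
    qed
    then obtain \<phi> where "Q \<phi>" "\<forall>e\<in>E. \<phi> e = \<psi> e0" by auto
    then show False using e0(2) G_cong[of \<phi> "\<lambda>_. \<psi> e0"] by (auto simp: Q_def)
  qed
  moreover have "card E \<noteq> 0" using e0(1) finite_E by auto
  ultimately show ?thesis
    by (simp add: prod_nonneg G_nonneg zero_power)
next
  case False
  define N where "N = (\<lambda>x. G (\<lambda>_. x))"
  have N_pos: "0 < N (\<psi> e)" if "e \<in> E" for e
    using False G_nonneg[of "\<lambda>_. \<psi> e"] that by (auto simp: N_def order_less_le)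
  define D where "D \<phi> = (\<Prod>e\<in>E. N (\<phi> e))" for \<phi>
  \<comment> \<open>The exponent makes \<open>J\<close> equal to 1 on constant colourings by colours
    of \<psi>.\<close>
  define J where "J \<phi> = G \<phi> ^ card E / D \<phi>" for \<phi>
  have D_pos: "0 < D \<phi>" if "\<phi> ` E \<subseteq> \<psi> ` E" for \<phi>
    unfolding D_def using that N_pos by (intro prod_pos) (auto simp: image_subset_iff image_iff)
  have J_nonneg: "0 \<le> J \<phi>" if "\<phi> ` E \<subseteq> \<psi> ` E" for \<phi>
    using D_pos[OF that] G_nonneg[of \<phi>] by (simp add: J_def)
  have J_fold: "(J \<phi>)\<^sup>2 \<le> J (fold_along P \<tau> \<phi>) * J (fold_along (E - P) \<tau> \<phi>)"
    if \<phi>: "\<phi> ` E \<subseteq> \<psi> ` E" and P: "(P, \<tau>) \<in> T" for \<phi> P \<tau>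
  proof -
    have "(G \<phi> ^ card E)\<^sup>2 = ((G \<phi>)\<^sup>2) ^ card E" by (simp add: power_mult[symmetric] mult.commute)
    also have "\<dots> \<le> (G (fold_along P \<tau> \<phi>) * G (fold_along (E - P) \<tau> \<phi>)) ^ card E"
      using \<phi> \<psi> P by (intro power_mono G_fold) auto
    finally have "(G \<phi> ^ card E)\<^sup>2 / (D \<phi>)\<^sup>2
        \<le> (G (fold_along P \<tau> \<phi>) * G (fold_along (E - P) \<tau> \<phi>)) ^ card E / (D \<phi>)\<^sup>2"
      by (rule divide_right_mono) simp
    moreover have "(D \<phi>)\<^sup>2 = D (fold_along P \<tau> \<phi>) * D (fold_along (E - P) \<tau> \<phi>)"
      using prod_folds[OF P, of N \<phi>] by (simp add: D_def)
    ultimately show ?thesis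
      by (simp add: J_def power_divide power_mult_distrib)
  qed
  \<comment> \<open>Up to values outside \<open>E\<close> only finitely many colourings use the
    colours of \<psi>, so \<open>J\<close> has a maximum.\<close>
  let ?F = "E \<rightarrow>\<^sub>E \<psi> ` E"
  have J_restrict: "J \<phi> \<in> J ` ?F" if "\<phi> ` E \<subseteq> \<psi> ` E" for \<phi>
  proof
    have "G (restrict \<phi> E) = G \<phi>" by (rule G_cong) simp
    moreover have "D (restrict \<phi> E) = D \<phi>" by (simp add: D_def)
    ultimately show "J \<phi> = J (restrict \<phi> E)" by (simp add: J_def)
    show "restrict \<phi> E \<in> ?F" using that by auto
  qed
  have fin: "finite (J ` ?F)" using finite_E by (intro finite_imageI finite_PiE) auto
  define M where "M = Max (J ` ?F)"
  have le_M: "J \<phi> \<le> M" if "\<phi> ` E \<subseteq> \<psi> ` E" for \<phi>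
    unfolding M_def using fin J_restrict[OF that] by simp
  have "J ` ?F \<noteq> {}" using J_restrict[of \<psi>] by auto
  then have "M \<in> J ` ?F" unfolding M_def using fin by (rule Max_in[rotated])
  then obtain \<phi> where \<phi>: "\<phi> ` E \<subseteq> \<psi> ` E" "J \<phi> = M" by auto
  have "M \<le> 1"
  proof (cases "E = {} \<or> M \<le> 0")
    case True
    then show ?thesis using \<phi>(2) by (auto simp: J_def D_def)
  next
    case False
    then obtain e0 where e0: "e0 \<in> E" by auto
    have M: "0 < M" using False by auto
    define Q where "Q \<phi> \<longleftrightarrow> \<phi> ` E \<subseteq> \<psi> ` E \<and> J \<phi> = M" for \<phi>
    have "\<exists>\<phi>'. Q \<phi>' \<and> (\<forall>e\<in>E. \<phi>' e = \<phi> e0)"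
    proof (rule percolation[OF e0])
      show "Q \<phi>" using \<phi> by (simp add: Q_def)
      fix \<phi> P \<tau> assume Q: "Q \<phi>" and P: "(P, \<tau>) \<in> T"
      then have \<phi>: "\<phi> ` E \<subseteq> \<psi> ` E" "J \<phi> = M" by (simp_all add: Q_def)
      have "M * M \<le> J (fold_along P \<tau> \<phi>) * J (fold_along (E - P) \<tau> \<phi>)"
        using J_fold[OF \<phi>(1) P] \<phi>(2) by (simp add: power2_eq_square)
      \<comment> \<open>The complementary fold is bounded by the maximum; cancelling
        \<open>M\<close> shows that the fold towards \<open>e0\<close> attains it.\<close>
      also have "\<dots> \<le> J (fold_along P \<tau> \<phi>) * M"
        using fold_along_image[OF \<phi>(1)] P fold_compl[OF P] by (intro mult_left_mono le_M J_nonneg) auto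
      finally have "M \<le> J (fold_along P \<tau> \<phi>)" using M by simp
      then show "Q (fold_along P \<tau> \<phi>)"
        unfolding Q_def using le_M fold_along_image[OF \<phi>(1) P] by (auto intro: antisym)
    qed
    then obtain \<phi>' where \<phi>': "Q \<phi>'" "\<forall>e\<in>E. \<phi>' e = \<phi> e0" by auto
    have "G \<phi>' = N (\<phi> e0)" unfolding N_def using \<phi>'(2) by (intro G_cong) auto
    moreover have "D \<phi>' = N (\<phi> e0) ^ card E" using \<phi>'(2) by (simp add: D_def)
    moreover have "D \<phi>' > 0" using \<phi>'(1) by (intro D_pos) (simp add: Q_def)
    ultimately show ?thesis using \<phi>'(1) by (auto simp: Q_def J_def split: if_splits)
  qed
  then have "J \<psi> \<le> 1" using le_M[of \<psi>] by simp
  then show ?thesis using D_pos[of \<psi>] by (simp add: J_def D_def N_def pos_divide_le_eq)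
qed

end

section \<open>Integrals over decorated graphs\<close>

lemma (in prob_space) integral_Cauchy_Schwarz:
  fixes u v :: "'a \<Rightarrow> real"
  assumes [measurable]: "u \<in> borel_measurable M" "v \<in> borel_measurable M"
    and u: "\<And>x. x \<in> space M \<Longrightarrow> \<bar>u x\<bar> \<le> B" and v: "\<And>x. x \<in> space M \<Longrightarrow> \<bar>v x\<bar> \<le> C"
  shows "(\<integral>x. u x * v x \<partial>M)\<^sup>2 \<le> (\<integral>x. u x * u x \<partial>M) * (\<integral>x. v x * v x \<partial>M)"
proof -
  have int: "integrable M (\<lambda>x. f x * g x)"
    if [measurable]: "f \<in> borel_measurable M" "g \<in> borel_measurable M"
      and f: "\<And>x. x \<in> space M \<Longrightarrow> \<bar>f x\<bar> \<le> K" and g: "\<And>x. x \<in> space M \<Longrightarrow> \<bar>g x\<bar> \<le> L"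
    for f g :: "'a \<Rightarrow> real" and K L
    using f g by (intro integrable_const_bound[where B = "K * L"])
      (auto simp: abs_mult intro!: AE_I2 mult_mono intro: order_trans[OF abs_ge_zero])
  define a b c where "a = (\<integral>x. u x * u x \<partial>M)" and "b = (\<integral>x. v x * v x \<partial>M)"
    and "c = (\<integral>x. u x * v x \<partial>M)"
  have quad: "0 \<le> s * s * a + 2 * s * t * c + t * t * b" for s t
  proof -
    have "0 \<le> (\<integral>x. (s * u x + t * v x) * (s * u x + t * v x) \<partial>M)"
      by (rule Bochner_Integration.integral_nonneg) simp
    also have "(\<lambda>x. (s * u x + t * v x) * (s * u x + t * v x))
        = (\<lambda>x. s * s * (u x * u x) + 2 * s * t * (u x * v x) + t * t * (v x * v x))"
      by (auto simp: algebra_simps)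
    also have "(\<integral>x. s * s * (u x * u x) + 2 * s * t * (u x * v x) + t * t * (v x * v x) \<partial>M)
        = s * s * a + 2 * s * t * c + t * t * b"
      unfolding a_def b_def c_def using u v
      by (simp add: int[of u u B B] int[of u v B C] int[of v v C C])
    finally show ?thesis .
  qed
  have "c * c \<le> a * b"
  proof (cases "a = 0")
    case False
    then have "0 < a" using quad[of 1 0] by simp
    \<comment> \<open>The discriminant argument: \<open>s = - c\<close> and \<open>t = a\<close>
      turn the form into this product.\<close>
    have "0 \<le> a * (a * b - c * c)"
      using quad[of "- c" a] by (simp add: algebra_simps)
    then show ?thesis using \<open>0 < a\<close> by (simp add: zero_le_mult_iff)
  next
    case True
    have "c = 0"
    proof (rule ccontr)
      assume "c \<noteq> 0"
      \<comment> \<open>With \<open>a = 0\<close> the first choice gives the form the value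
        -1.\<close>
      then show False using quad[of "- (b + 1) / (2 * c)" 1] quad[of 0 1] True by (simp add: field_simps)
    qed
    then show ?thesis using True by simp
  qed
  then show ?thesis by (simp add: a_def b_def c_def power2_eq_square)
qed

text \<open>Edges are an index set with two end maps, so that group elements can serve as edges.
  Both ends lie in one vertex set because a reflection acts on all vertices at once.\<close>

locale edge_integral = prob_space M for M :: "'a measure" +
  fixes V :: "'v set" and E :: "'e set" and l r :: "'e \<Rightarrow> 'v"
  assumes finite_V: "finite V" and finite_E: "finite E"
    and ends: "e \<in> E \<Longrightarrow> l e \<in> V" "e \<in> E \<Longrightarrow> r e \<in> V"
begin

text \<open>The bound is demanded at all points, so that products are bounded at every assignment
  without reference to the underlying space.\<close>

definition weights :: "('a \<times> 'a \<Rightarrow> real) set" where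
  "weights = {f \<in> borel_measurable (M \<Otimes>\<^sub>M M). \<exists>B. \<forall>p. \<bar>f p\<bar> \<le> B}"

definition edge_prod :: "'e set \<Rightarrow> ('e \<Rightarrow> 'a \<times> 'a \<Rightarrow> real) \<Rightarrow> ('v \<Rightarrow> 'a) \<Rightarrow> real" where
  "edge_prod A \<phi> u = (\<Prod>e\<in>A. \<phi> e (u (l e), u (r e)))"

definition edge_int :: "('e \<Rightarrow> 'a \<times> 'a \<Rightarrow> real) \<Rightarrow> real" where
  "edge_int \<phi> = (\<integral>u. edge_prod E \<phi> u \<partial>(\<Pi>\<^sub>M v\<in>V. M))"

sublocale P: product_sigma_finite "\<lambda>_. M" by standard

lemma prob_PiM: "prob_space (\<Pi>\<^sub>M v\<in>U. M)"
  by (rule prob_space_PiM) unfold_locales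

lemma edge_int_cong: "(\<And>e. e \<in> E \<Longrightarrow> \<phi> e = \<psi> e) \<Longrightarrow> edge_int \<phi> = edge_int \<psi>"
  unfolding edge_int_def edge_prod_def by (auto intro!: Bochner_Integration.integral_cong prod.cong)

lemma edge_prod_measurable:
  assumes "A \<subseteq> E" "\<And>e. e \<in> A \<Longrightarrow> \<phi> e \<in> weights" "\<And>e. e \<in> A \<Longrightarrow> l e \<in> U \<and> r e \<in> U"
  shows "edge_prod A \<phi> \<in> borel_measurable (\<Pi>\<^sub>M v\<in>U. M)"
  unfolding edge_prod_def
proof (rule borel_measurable_prod)
  fix e assume e: "e \<in> A"
  have "\<phi> e \<in> borel_measurable (M \<Otimes>\<^sub>M M)" using assms(2)[OF e] by (simp add: weights_def)
  moreover have "(\<lambda>u. (u (l e), u (r e))) \<in> (\<Pi>\<^sub>M v\<in>U. M) \<rightarrow>\<^sub>M M \<Otimes>\<^sub>M M"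
    using assms(3)[OF e] by (intro measurable_Pair measurable_component_singleton) auto
  ultimately show "(\<lambda>u. \<phi> e (u (l e), u (r e))) \<in> borel_measurable (\<Pi>\<^sub>M v\<in>U. M)"
    by (rule measurable_compose[rotated])
qed

lemma edge_prod_bounded:
  assumes "\<And>e. e \<in> A \<Longrightarrow> \<phi> e \<in> weights"
  shows "\<exists>B. \<forall>u. \<bar>edge_prod A \<phi> u\<bar> \<le> B"
proof -
  have "\<forall>e\<in>A. \<exists>B. \<forall>p. \<bar>\<phi> e p\<bar> \<le> B" using assms by (auto simp: weights_def)
  then obtain b where b: "\<And>e p. e \<in> A \<Longrightarrow> \<bar>\<phi> e p\<bar> \<le> b e" by metis
  have "\<bar>edge_prod A \<phi> u\<bar> \<le> (\<Prod>e\<in>A. b e)" for u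
    unfolding edge_prod_def abs_prod using b by (intro prod_mono) auto
  then show ?thesis by blast
qed

lemma edge_prod_integrable:
  assumes "A \<subseteq> E" "\<And>e. e \<in> A \<Longrightarrow> \<phi> e \<in> weights" "\<And>e. e \<in> A \<Longrightarrow> l e \<in> U \<and> r e \<in> U"
  shows "integrable (\<Pi>\<^sub>M v\<in>U. M) (edge_prod A \<phi>)"
proof -
  interpret U: prob_space "\<Pi>\<^sub>M v\<in>U. M" by (rule prob_PiM)
  obtain B where "\<forall>u. \<bar>edge_prod A \<phi> u\<bar> \<le> B" using edge_prod_bounded[of A \<phi>] assms(2) by blast
  then show ?thesis
    using edge_prod_measurable[OF assms] by (intro U.integrable_const_bound[where B = B]) auto
qed

lemma edge_prod_cong: "(\<And>e. e \<in> A \<Longrightarrow> \<phi> e = \<psi> e \<and> u (l e) = w (l e) \<and> u (r e) = w (r e)) \<Longrightarrow>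
    edge_prod A \<phi> u = edge_prod A \<psi> w"
  unfolding edge_prod_def by (auto intro!: prod.cong)

text \<open>A reflection \<open>\<sigma>\<close> of the vertices exchanges \<open>R\<close> with \<open>R'\<close> and fixes \<open>F\<close>, the involution \<open>\<tau>\<close>
  exchanges the edges in \<open>P\<close> with the others; in particular no edge lies inside \<open>F\<close>.
  Integrating out \<open>R\<close> and \<open>R'\<close>
  separately gives two functions on the cube over \<open>F\<close>.\<close>

context
  fixes F R R' :: "'v set" and \<sigma> :: "'v \<Rightarrow> 'v" and P :: "'e set" and \<tau> :: "'e \<Rightarrow> 'e"
  assumes V: "V = F \<union> R \<union> R'" and disj: "F \<inter> R = {}" "F \<inter> R' = {}" "R \<inter> R' = {}"
    and \<sigma>_fix: "\<And>v. v \<in> F \<Longrightarrow> \<sigma> v = v" and \<sigma>_bij: "bij_betw \<sigma> R R'"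
    and P: "P \<subseteq> E" and \<tau>_inv: "\<And>e. e \<in> E \<Longrightarrow> \<tau> (\<tau> e) = e"
    and \<tau>_swap: "\<And>e. e \<in> E \<Longrightarrow> \<tau> e \<in> E \<and> (\<tau> e \<in> P \<longleftrightarrow> e \<notin> P)"
    and ends_P: "\<And>e. e \<in> P \<Longrightarrow> l e \<in> F \<union> R \<and> r e \<in> F \<union> R"
    and ends_\<tau>: "\<And>e. e \<in> P \<Longrightarrow> l (\<tau> e) = \<sigma> (l e) \<and> r (\<tau> e) = \<sigma> (r e)"
begin

text \<open>\<open>x\<close> enters only through its values on \<open>F\<close>, so the function may
  also be evaluated at assignments on a larger set of vertices.\<close>

definition half_int :: "('e \<Rightarrow> 'a \<times> 'a \<Rightarrow> real) \<Rightarrow> ('v \<Rightarrow> 'a) \<Rightarrow> real" where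
  "half_int \<phi> x = (\<integral>y. edge_prod P \<phi> (merge F R (x, y)) \<partial>(\<Pi>\<^sub>M v\<in>R. M))"

lemma finite_parts: "finite F" "finite R" "finite R'"
  using finite_V V by auto

lemma half_int_cong: "(\<And>e. e \<in> P \<Longrightarrow> \<phi> e = \<psi> e) \<Longrightarrow> half_int \<phi> x = half_int \<psi> x"
  unfolding half_int_def by (auto intro!: Bochner_Integration.integral_cong edge_prod_cong)

lemma half_int_measurable:
  assumes \<phi>: "\<And>e. e \<in> P \<Longrightarrow> \<phi> e \<in> weights"
  shows "half_int \<phi> \<in> borel_measurable (\<Pi>\<^sub>M v\<in>F. M)"
proof -
  interpret R: prob_space "\<Pi>\<^sub>M v\<in>R. M" by (rule prob_PiM)
  have "(\<lambda>p. edge_prod P \<phi> (merge F R p)) \<in> borel_measurable ((\<Pi>\<^sub>M v\<in>F. M) \<Otimes>\<^sub>M (\<Pi>\<^sub>M v\<in>R. M))"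
    by (rule measurable_compose[OF measurable_merge edge_prod_measurable[OF P \<phi>]])
       (use ends_P in auto)
  then show ?thesis
    unfolding half_int_def[abs_def] by (intro R.borel_measurable_lebesgue_integral) (simp add: case_prod_eta)
qed

lemma half_int_bounded:
  assumes \<phi>: "\<And>e. e \<in> P \<Longrightarrow> \<phi> e \<in> weights"
  shows "\<exists>B. \<forall>x\<in>space (\<Pi>\<^sub>M v\<in>F. M). \<bar>half_int \<phi> x\<bar> \<le> B"
proof -
  interpret R: prob_space "\<Pi>\<^sub>M v\<in>R. M" by (rule prob_PiM)
  obtain B where B: "\<forall>u. \<bar>edge_prod P \<phi> u\<bar> \<le> B" using edge_prod_bounded[of P \<phi>] \<phi> by blast
  have "\<bar>half_int \<phi> x\<bar> \<le> B" if x: "x \<in> space (\<Pi>\<^sub>M v\<in>F. M)" for x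
  proof -
    have m: "(\<lambda>y. edge_prod P \<phi> (merge F R (x, y))) \<in> borel_measurable (\<Pi>\<^sub>M v\<in>R. M)"
      by (rule measurable_compose[OF measurable_compose[OF measurable_Pair1'[OF x] measurable_merge]
            edge_prod_measurable[OF P \<phi>]]) (use ends_P in auto)
    have "\<bar>half_int \<phi> x\<bar> \<le> (\<integral>y. \<bar>edge_prod P \<phi> (merge F R (x, y))\<bar> \<partial>(\<Pi>\<^sub>M v\<in>R. M))"
      unfolding half_int_def by (rule integral_abs_bound)
    also have "\<dots> \<le> (\<integral>y. B \<partial>(\<Pi>\<^sub>M v\<in>R. M))"
      using B m by (intro integral_mono R.integrable_const_bound[where B = B]) auto
    also have "\<dots> = B" by (simp add: R.prob_space)
    finally show ?thesis .
  qed
  then show ?thesis by blast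
qed

text \<open>Fubini, twice. When \<open>R'\<close> is integrated out, the edges in \<open>P\<close>
  factor out, and renaming vertices along \<sigma> turns the other edges into \<phi> \<circ> \<tau>
  on \<open>P\<close>. The result of that step sees only \<open>F\<close>, so it factors out of the
  integral over \<open>R\<close>.\<close>

lemma edge_int_halves:
  assumes \<phi>: "\<And>e. e \<in> E \<Longrightarrow> \<phi> e \<in> weights"
  shows "edge_int \<phi> = (\<integral>x. half_int \<phi> x * half_int (\<phi> \<circ> \<tau>) x \<partial>(\<Pi>\<^sub>M v\<in>F. M))"
proof -
  interpret R: prob_space "\<Pi>\<^sub>M v\<in>R. M" by (rule prob_PiM)
  interpret FR: prob_space "\<Pi>\<^sub>M v\<in>F \<union> R. M" by (rule prob_PiM)
  define \<rho> where "\<rho> = the_inv_into R \<sigma>"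
  have \<rho>: "bij_betw \<rho> R' R" "\<And>v. v \<in> R \<Longrightarrow> \<rho> (\<sigma> v) = v"
    unfolding \<rho>_def using \<sigma>_bij
    by (auto intro: bij_betw_the_inv_into the_inv_into_f_f dest: bij_betw_imp_inj_on)
  have \<sigma>R: "\<sigma> v \<in> R'" if "v \<in> R" for v using \<sigma>_bij that by (auto simp: bij_betw_def)
  have \<tau>P: "\<tau> e \<in> E - P" if "e \<in> P" for e using \<tau>_swap[of e] that P by auto
  have \<phi>P: "\<phi> e \<in> weights" "(\<phi> \<circ> \<tau>) e \<in> weights" if "e \<in> P" for e
    using \<phi> P \<tau>P that by auto
  have bij: "bij_betw \<tau> P (E - P)"
    using \<tau>_inv \<tau>_swap P by (intro bij_betw_byWitness[where f' = \<tau>]) auto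
  have opposite: "edge_prod (E - P) \<phi> u = (\<Prod>e\<in>P. \<phi> (\<tau> e) (u (\<sigma> (l e)), u (\<sigma> (r e))))" for u
    unfolding edge_prod_def using ends_\<tau>
    by (subst prod.reindex_bij_betw[OF bij, symmetric]) (auto intro!: prod.cong)
  have split: "edge_prod E \<phi> u = edge_prod P \<phi> u * edge_prod (E - P) \<phi> u" for u
    unfolding edge_prod_def using finite_E P by (subst prod.subset_diff[of P]) (auto simp: mult.commute)
  \<comment> \<open>Renaming coordinates along the inverse of \<sigma> carries the cube over
    \<open>R\<close> to the cube over \<open>R'\<close>.\<close>
  have reindex: "(\<Pi>\<^sub>M v\<in>R'. M) = distr (\<Pi>\<^sub>M v\<in>R. M) (\<Pi>\<^sub>M v\<in>R'. M) (\<lambda>y. \<lambda>v\<in>R'. y (\<rho> v))"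
    using \<rho>(1) by (intro distr_PiM_reindex[symmetric]) (auto simp: bij_betw_def prob_space_axioms)
  have reindex_meas: "(\<lambda>y. \<lambda>v\<in>R'. y (\<rho> v)) \<in> (\<Pi>\<^sub>M v\<in>R. M) \<rightarrow>\<^sub>M (\<Pi>\<^sub>M v\<in>R'. M)"
    using \<rho>(1) by (intro measurable_restrict measurable_component_singleton) (auto simp: bij_betw_def)
  have ends_E: "l e \<in> F \<union> R \<union> R' \<and> r e \<in> F \<union> R \<union> R'" if "e \<in> E" for e
    using ends[OF that] V by auto
  have inner: "(\<integral>z. edge_prod E \<phi> (merge (F \<union> R) R' (u, z)) \<partial>(\<Pi>\<^sub>M v\<in>R'. M))
      = edge_prod P \<phi> u * half_int (\<phi> \<circ> \<tau>) u" if u: "u \<in> space (\<Pi>\<^sub>M v\<in>F \<union> R. M)" for u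
  proof -
    have d: "(F \<union> R) \<inter> R' = {}" using disj by auto
    have "edge_prod E \<phi> (merge (F \<union> R) R' (u, z))
        = edge_prod P \<phi> u * edge_prod (E - P) \<phi> (merge (F \<union> R) R' (u, z))" for z
      unfolding split using ends_P d by (auto intro!: edge_prod_cong)
    moreover have "(\<integral>z. edge_prod (E - P) \<phi> (merge (F \<union> R) R' (u, z)) \<partial>(\<Pi>\<^sub>M v\<in>R'. M))
        = half_int (\<phi> \<circ> \<tau>) u"
    proof -
      have meas: "(\<lambda>z. edge_prod (E - P) \<phi> (merge (F \<union> R) R' (u, z))) \<in> borel_measurable (\<Pi>\<^sub>M v\<in>R'. M)"
        by (rule measurable_compose[OF measurable_compose[OF measurable_Pair1'[OF u] measurable_merge]
              edge_prod_measurable]) (use ends_E \<phi> in auto)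
      have "(\<integral>z. edge_prod (E - P) \<phi> (merge (F \<union> R) R' (u, z)) \<partial>(\<Pi>\<^sub>M v\<in>R'. M))
          = (\<integral>y. edge_prod (E - P) \<phi> (merge (F \<union> R) R' (u, \<lambda>v\<in>R'. y (\<rho> v))) \<partial>(\<Pi>\<^sub>M v\<in>R. M))"
        by (subst reindex) (rule integral_distr[OF reindex_meas meas])
      also have "\<dots> = half_int (\<phi> \<circ> \<tau>) u"
        unfolding half_int_def
      proof (rule Bochner_Integration.integral_cong[OF refl])
        fix y
        have vert: "merge (F \<union> R) R' (u, \<lambda>v\<in>R'. y (\<rho> v)) (\<sigma> v) = merge F R (u, y) v"
          if "v \<in> F \<union> R" for v
          using that disj d \<sigma>_fix[of v] \<sigma>R[of v] \<rho>(2)[of v] by (cases "v \<in> F") auto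
        show "edge_prod (E - P) \<phi> (merge (F \<union> R) R' (u, \<lambda>v\<in>R'. y (\<rho> v)))
            = edge_prod P (\<phi> \<circ> \<tau>) (merge F R (u, y))"
          unfolding opposite edge_prod_def[of P] using vert ends_P by (intro prod.cong) auto
      qed
      finally show ?thesis .
    qed
    ultimately show ?thesis by simp
  qed
  have half_F: "half_int (\<phi> \<circ> \<tau>) (merge F R (x, y)) = half_int (\<phi> \<circ> \<tau>) x" for x y
  proof -
    have "merge F R (merge F R (x, y), z) = merge F R (x, z)" for z
      using disj by (auto simp: merge_def)
    then show ?thesis by (simp add: half_int_def)
  qed
  have half_meas: "half_int (\<phi> \<circ> \<tau>) \<in> borel_measurable (\<Pi>\<^sub>M v\<in>F \<union> R. M)"
  proof -
    have "half_int (\<phi> \<circ> \<tau>) u = half_int (\<phi> \<circ> \<tau>) (restrict u F)" for u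
      by (simp add: half_int_def)
    moreover have "(\<lambda>u. half_int (\<phi> \<circ> \<tau>) (restrict u F)) \<in> borel_measurable (\<Pi>\<^sub>M v\<in>F \<union> R. M)"
      by (rule measurable_compose[OF measurable_restrict_subset half_int_measurable])
         (use \<phi>P in auto)
    ultimately show ?thesis by simp
  qed
  obtain B where B: "\<forall>u. \<bar>edge_prod P \<phi> u\<bar> \<le> B" using edge_prod_bounded[of P \<phi>] \<phi>P(1) by blast
  obtain C where C: "\<forall>x\<in>space (\<Pi>\<^sub>M v\<in>F. M). \<bar>half_int (\<phi> \<circ> \<tau>) x\<bar> \<le> C"
    using half_int_bounded[of "\<phi> \<circ> \<tau>"] \<phi>P(2) by blast
  have C': "\<bar>half_int (\<phi> \<circ> \<tau>) u\<bar> \<le> C" if "u \<in> space (\<Pi>\<^sub>M v\<in>F \<union> R. M)" for u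
  proof -
    have "restrict u F \<in> space (\<Pi>\<^sub>M v\<in>F. M)" using that by (auto simp: space_PiM)
    moreover have "half_int (\<phi> \<circ> \<tau>) u = half_int (\<phi> \<circ> \<tau>) (restrict u F)"
      by (simp add: half_int_def)
    ultimately show ?thesis using C by simp
  qed
  have int: "integrable (\<Pi>\<^sub>M v\<in>F \<union> R. M) (\<lambda>u. edge_prod P \<phi> u * half_int (\<phi> \<circ> \<tau>) u)"
  proof (rule FR.integrable_const_bound[where B = "B * C"])
    show "AE u in \<Pi>\<^sub>M v\<in>F \<union> R. M. norm (edge_prod P \<phi> u * half_int (\<phi> \<circ> \<tau>) u) \<le> B * C"
      using B C' by (auto simp: abs_mult intro!: AE_I2 mult_mono intro: order_trans[OF abs_ge_zero])
    show "(\<lambda>u. edge_prod P \<phi> u * half_int (\<phi> \<circ> \<tau>) u) \<in> borel_measurable (\<Pi>\<^sub>M v\<in>F \<union> R. M)"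
      using edge_prod_measurable[OF P \<phi>P(1)] ends_P half_meas by (intro borel_measurable_times) auto
  qed
  have "edge_int \<phi> = (\<integral>u. edge_prod E \<phi> u \<partial>(\<Pi>\<^sub>M v\<in>(F \<union> R) \<union> R'. M))"
    by (simp only: edge_int_def V[symmetric])
  also have "\<dots> = (\<integral>u. \<integral>z. edge_prod E \<phi> (merge (F \<union> R) R' (u, z)) \<partial>(\<Pi>\<^sub>M v\<in>R'. M) \<partial>(\<Pi>\<^sub>M v\<in>F \<union> R. M))"
    using disj finite_parts edge_prod_integrable[OF order_refl \<phi>] ends_E
    by (intro P.product_integral_fold) auto
  also have "\<dots> = (\<integral>u. edge_prod P \<phi> u * half_int (\<phi> \<circ> \<tau>) u \<partial>(\<Pi>\<^sub>M v\<in>F \<union> R. M))"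
    by (rule Bochner_Integration.integral_cong) (simp_all add: inner)
  also have "\<dots> = (\<integral>x. \<integral>y. edge_prod P \<phi> (merge F R (x, y)) * half_int (\<phi> \<circ> \<tau>) (merge F R (x, y))
      \<partial>(\<Pi>\<^sub>M v\<in>R. M) \<partial>(\<Pi>\<^sub>M v\<in>F. M))"
    using disj finite_parts int by (intro P.product_integral_fold) auto
  also have "\<dots> = (\<integral>x. half_int \<phi> x * half_int (\<phi> \<circ> \<tau>) x \<partial>(\<Pi>\<^sub>M v\<in>F. M))"
    unfolding half_F by (simp add: half_int_def[of \<phi>])
  finally show ?thesis .
qed

text \<open>Cauchy-Schwarz over the cube on \<open>F\<close>. After a fold both halves carry the
  same decoration, so the two integrals of squares are exactly the integrals of the two
  folds.\<close>

lemma edge_int_fold: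
  assumes \<phi>: "\<And>e. e \<in> E \<Longrightarrow> \<phi> e \<in> weights"
  shows "(edge_int \<phi>)\<^sup>2 \<le> edge_int (fold_along P \<tau> \<phi>) * edge_int (fold_along (E - P) \<tau> \<phi>)"
proof -
  interpret F: prob_space "\<Pi>\<^sub>M v\<in>F. M" by (rule prob_PiM)
  have \<tau>P: "\<tau> e \<in> E - P" if "e \<in> P" for e using \<tau>_swap[of e] that P by auto
  have \<phi>P: "\<phi> e \<in> weights" "(\<phi> \<circ> \<tau>) e \<in> weights" if "e \<in> P" for e
    using \<phi> P \<tau>P that by auto
  obtain B C where "\<forall>x\<in>space (\<Pi>\<^sub>M v\<in>F. M). \<bar>half_int \<phi> x\<bar> \<le> B"
      "\<forall>x\<in>space (\<Pi>\<^sub>M v\<in>F. M). \<bar>half_int (\<phi> \<circ> \<tau>) x\<bar> \<le> C"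
    using half_int_bounded[of \<phi>] half_int_bounded[of "\<phi> \<circ> \<tau>"] \<phi>P by meson
  moreover have "edge_int \<phi> = (\<integral>x. half_int \<phi> x * half_int (\<phi> \<circ> \<tau>) x \<partial>(\<Pi>\<^sub>M v\<in>F. M))"
    by (rule edge_int_halves) (rule \<phi>)
  ultimately have "(edge_int \<phi>)\<^sup>2 \<le> (\<integral>x. half_int \<phi> x * half_int \<phi> x \<partial>(\<Pi>\<^sub>M v\<in>F. M))
      * (\<integral>x. half_int (\<phi> \<circ> \<tau>) x * half_int (\<phi> \<circ> \<tau>) x \<partial>(\<Pi>\<^sub>M v\<in>F. M))"
    using F.integral_Cauchy_Schwarz[of "half_int \<phi>" "half_int (\<phi> \<circ> \<tau>)" B C]
      half_int_measurable[of \<phi>] half_int_measurable[of "\<phi> \<circ> \<tau>"] \<phi>P by simp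
  moreover have "edge_int (fold_along P \<tau> \<phi>) = (\<integral>x. half_int \<phi> x * half_int \<phi> x \<partial>(\<Pi>\<^sub>M v\<in>F. M))"
  proof -
    have "half_int (fold_along P \<tau> \<phi>) x = half_int \<phi> x"
        "half_int (fold_along P \<tau> \<phi> \<circ> \<tau>) x = half_int \<phi> x" for x
      using \<tau>P \<tau>_inv P by (auto intro!: half_int_cong simp: fold_along_def)
    moreover have "fold_along P \<tau> \<phi> e \<in> weights" if "e \<in> E" for e
      using that \<tau>_swap \<phi> by (auto simp: fold_along_def)
    ultimately show ?thesis by (simp add: edge_int_halves)
  qed
  moreover have "edge_int (fold_along (E - P) \<tau> \<phi>)
      = (\<integral>x. half_int (\<phi> \<circ> \<tau>) x * half_int (\<phi> \<circ> \<tau>) x \<partial>(\<Pi>\<^sub>M v\<in>F. M))"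
  proof -
    have "half_int (fold_along (E - P) \<tau> \<phi>) x = half_int (\<phi> \<circ> \<tau>) x"
        "half_int (fold_along (E - P) \<tau> \<phi> \<circ> \<tau>) x = half_int (\<phi> \<circ> \<tau>) x" for x
      using \<tau>P P by (auto intro!: half_int_cong simp: fold_along_def)
    moreover have "fold_along (E - P) \<tau> \<phi> e \<in> weights" if "e \<in> E" for e
      using that \<tau>_swap \<phi> by (auto simp: fold_along_def)
    ultimately show ?thesis by (simp add: edge_int_halves)
  qed
  ultimately show ?thesis by simp
qed

end

end

section \<open>Null sets and Borel representatives\<close>

lemma borel_measurable_completion_AE:
  fixes f g :: "'a \<Rightarrow> real"
  assumes g: "g \<in> borel_measurable M" and AE: "AE x in M. f x = g x"
  shows "f \<in> borel_measurable (completion M)"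
proof (rule measurableI)
  fix A :: "real set" assume A: "A \<in> sets borel"
  have ae: "AE x in completion M. x \<in> g -` A \<inter> space M \<longleftrightarrow> x \<in> f -` A \<inter> space M"
    using AE_completion[OF AE] by eventually_elim auto
  have "f -` A \<inter> space M \<in> sets (completion M)"
    by (rule completion.in_sets_AE[OF ae]) (use measurable_sets[OF g A] in auto)
  then show "f -` A \<inter> space (completion M) \<in> sets (completion M)" by simp
qed simp

abbreviation unit_measure :: "real measure" where
  "unit_measure \<equiv> restrict_space lborel {0..1}"

lemma prob_space_unit_measure: "prob_space unit_measure"
  by (rule prob_spaceI) (simp add: emeasure_restrict_space space_restrict_space)

interpretation unit: prob_space unit_measure
  by (rule prob_space_unit_measure)

lemma unit_square_borel: "(\<lambda>p. p) \<in> unit_measure \<Otimes>\<^sub>M unit_measure \<rightarrow>\<^sub>M borel"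
proof -
  have id: "(\<lambda>x. x) \<in> unit_measure \<rightarrow>\<^sub>M borel"
    by (intro measurable_restrict_space1) simp
  show ?thesis
    using measurable_Pair[OF measurable_compose[OF measurable_fst id] measurable_compose[OF measurable_snd id]]
    by (simp add: borel_prod)
qed

text \<open>A Borel null set covering the exceptions can be sliced by Fubini, after which each
  coordinate is restricted to the unit interval separately.\<close>

lemma AE_unit_square:
  assumes "AE p in lborel :: (real \<times> real) measure. P p"
  shows "AE p in unit_measure \<Otimes>\<^sub>M unit_measure. P p"
proof -
  interpret U: pair_sigma_finite unit_measure unit_measure by standard
  obtain N where N: "{p. \<not> P p} \<subseteq> N" "emeasure lborel N = 0" "N \<in> sets lborel"
    using AE_E[OF assms] by (auto simp: space_borel)
  have "AE p in lborel \<Otimes>\<^sub>M lborel. p \<notin> N"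
    using N by (intro AE_not_in) (auto simp: lborel_prod)
  then have "AE x in lborel. AE y in lborel. (x, y) \<notin> N"
    by (rule lborel_pair.AE_pair)
  then have "AE x in lborel. x \<in> {0..1} \<longrightarrow> (AE y in lborel. y \<in> {0..1} \<longrightarrow> (x, y) \<notin> N)"
    by eventually_elim (auto elim: eventually_mono)
  then have "AE x in unit_measure. AE y in unit_measure. (x, y) \<notin> N"
    by (simp add: AE_restrict_space_iff)
  moreover have "{p \<in> space (unit_measure \<Otimes>\<^sub>M unit_measure). p \<notin> N} \<in> sets (unit_measure \<Otimes>\<^sub>M unit_measure)"
  proof -
    have "{p \<in> space (unit_measure \<Otimes>\<^sub>M unit_measure). p \<notin> N}
        = (\<lambda>p. p) -` (- N) \<inter> space (unit_measure \<Otimes>\<^sub>M unit_measure)" by auto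
    then show ?thesis using measurable_sets[OF unit_square_borel, of "- N"] N(3) by simp
  qed
  ultimately have "AE p in unit_measure \<Otimes>\<^sub>M unit_measure. p \<notin> N"
    by (intro U.AE_pair_measure)
  then show ?thesis by (rule eventually_mono) (use N(1) in auto)
qed

text \<open>Distinct coordinates are independent, so the pair is distributed as
  \<open>M \<Otimes>\<^sub>M M\<close>. The ends of an edge are distinct because they lie in
  different parts.\<close>

lemma (in prob_space) AE_PiM_pair:
  assumes i: "i \<in> V" "j \<in> V" "i \<noteq> j" and AE: "AE p in M \<Otimes>\<^sub>M M. P p"
  shows "AE x in (\<Pi>\<^sub>M v\<in>V. M). P (x i, x j)"
proof -
  interpret PP: product_prob_space "\<lambda>_. M" V by standard
  have [measurable]: "(\<lambda>x. (x i, x j)) \<in> (\<Pi>\<^sub>M v\<in>V. M) \<rightarrow>\<^sub>M M \<Otimes>\<^sub>M M"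
    using i by (intro measurable_Pair measurable_component_singleton) auto
  have eq: "M \<Otimes>\<^sub>M M = distr (\<Pi>\<^sub>M v\<in>V. M) (M \<Otimes>\<^sub>M M) (\<lambda>x. (x i, x j))"
  proof (rule pair_measure_eqI)
    fix A B assume AB: "A \<in> sets M" "B \<in> sets M"
    have "emeasure (distr (\<Pi>\<^sub>M v\<in>V. M) (M \<Otimes>\<^sub>M M) (\<lambda>x. (x i, x j))) (A \<times> B)
        = emeasure (\<Pi>\<^sub>M v\<in>V. M) ((\<lambda>x. (x i, x j)) -` (A \<times> B) \<inter> space (\<Pi>\<^sub>M v\<in>V. M))"
      using AB by (intro emeasure_distr) auto
    also have "(\<lambda>x. (x i, x j)) -` (A \<times> B) \<inter> space (\<Pi>\<^sub>M v\<in>V. M)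
        = {x \<in> space (\<Pi>\<^sub>M v\<in>V. M). \<forall>v\<in>{i, j}. x v \<in> (if v = i then A else B)}"
      using i by auto
    also have "emeasure (\<Pi>\<^sub>M v\<in>V. M) \<dots> = (\<Prod>v\<in>{i, j}. emeasure M (if v = i then A else B))"
      using i AB by (intro PP.emeasure_PiM_Collect) auto
    also have "\<dots> = emeasure M A * emeasure M B" using i by simp
    finally show "emeasure M A * emeasure M B
        = emeasure (distr (\<Pi>\<^sub>M v\<in>V. M) (M \<Otimes>\<^sub>M M) (\<lambda>x. (x i, x j))) (A \<times> B)" by simp
  qed (simp_all add: sigma_finite_measure_axioms)
  have "AE p in distr (\<Pi>\<^sub>M v\<in>V. M) (M \<Otimes>\<^sub>M M) (\<lambda>x. (x i, x j)). P p"
    using AE by (subst (asm) eq)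
  then show ?thesis by (rule AE_distrD[rotated]) measurable
qed

lemma borel_representative:
  assumes f: "f \<in> bounded_measurable"
  shows "\<exists>g\<in>borel_measurable (unit_measure \<Otimes>\<^sub>M unit_measure). (\<exists>B. \<forall>p. \<bar>g p\<bar> \<le> B) \<and>
    (AE p in unit_measure \<Otimes>\<^sub>M unit_measure. f p = g p)"
proof -
  let ?S = "{0..1} \<times> {0..1} :: (real \<times> real) set"
  have S: "?S \<in> sets lebesgue" by (intro sets_completionI_sets) (simp add: borel_closed closed_Times)
  have "f \<in> borel_measurable (lebesgue_on ?S)" using f by (simp add: bounded_measurable_def)
  then have "(\<lambda>p. if p \<in> ?S then f p else 0) \<in> borel_measurable lebesgue"
    using borel_measurable_if[OF S] by blast
  then obtain g where g: "g \<in> borel_measurable lborel"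
      "AE p in lborel. (if p \<in> ?S then f p else 0) = g p"
    using completion_ex_borel_measurable_real by blast
  obtain B where B: "\<And>p. p \<in> ?S \<Longrightarrow> \<bar>f p\<bar> \<le> B"
    using f by (auto simp: bounded_measurable_def bounded_iff)
  have "0 \<le> B" using B[of "(0, 0)"] by auto
  \<comment> \<open>Truncation at the bound of \<open>f\<close> gives a bound at every point and
    preserves almost everywhere equality on the square.\<close>
  define g' where "g' p = max (- B) (min B (g p))" for p
  have "g' \<in> borel_measurable borel"
    unfolding g'_def using g(1) by simp
  then have "g' \<in> borel_measurable (unit_measure \<Otimes>\<^sub>M unit_measure)"
    by (rule measurable_compose[OF unit_square_borel])
  moreover have "\<bar>g' p\<bar> \<le> B" for p using \<open>0 \<le> B\<close> by (auto simp: g'_def)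
  moreover have "AE p in unit_measure \<Otimes>\<^sub>M unit_measure. f p = g' p"
  proof -
    have "AE p in unit_measure \<Otimes>\<^sub>M unit_measure. p \<in> ?S"
      by (rule AE_I2) (auto simp: space_pair_measure space_restrict_space)
    with AE_unit_square[OF g(2)] show ?thesis
    proof eventually_elim
      case (elim p)
      then show ?case using B[of p] by (auto simp: g'_def)
    qed
  qed
  ultimately show ?thesis by blast
qed

section \<open>From the Hoelder inequality to the norming property\<close>

context edge_integral
begin

text \<open>Multilinear expansion, with \<open>X\<close> the set of edges that choose
  \<open>f\<close>.\<close>

lemma edge_int_add:
  assumes f: "f \<in> weights" and g: "g \<in> weights"
  shows "edge_int (\<lambda>_ p. f p + g p) = (\<Sum>X\<in>Pow E. edge_int (\<lambda>e. if e \<in> X then f else g))"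
proof -
  have "edge_prod E (\<lambda>_ p. f p + g p) u = (\<Sum>X\<in>Pow E. edge_prod E (\<lambda>e. if e \<in> X then f else g) u)" for u
  proof -
    have "edge_prod E (\<lambda>_ p. f p + g p) u = (\<Sum>X\<in>Pow E. (\<Prod>e\<in>X. f (u (l e), u (r e)))
        * (\<Prod>e\<in>E - X. g (u (l e), u (r e))))"
      unfolding edge_prod_def by (rule prod_add[OF finite_E])
    also have "\<dots> = (\<Sum>X\<in>Pow E. edge_prod E (\<lambda>e. if e \<in> X then f else g) u)"
    proof (rule sum.cong)
      fix X assume "X \<in> Pow E"
      then have X: "X \<subseteq> E" by simp
      show "(\<Prod>e\<in>X. f (u (l e), u (r e))) * (\<Prod>e\<in>E - X. g (u (l e), u (r e)))
          = edge_prod E (\<lambda>e. if e \<in> X then f else g) u"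
        unfolding edge_prod_def prod.subset_diff[OF X finite_E]
        by (subst mult.commute) (auto intro!: arg_cong2[where f = "(*)"] prod.cong)
    qed simp
    finally show ?thesis .
  qed
  then have "edge_int (\<lambda>_ p. f p + g p)
      = (\<integral>u. (\<Sum>X\<in>Pow E. edge_prod E (\<lambda>e. if e \<in> X then f else g) u) \<partial>(\<Pi>\<^sub>M v\<in>V. M))"
    by (simp add: edge_int_def)
  also have "\<dots> = (\<Sum>X\<in>Pow E. edge_int (\<lambda>e. if e \<in> X then f else g))"
    unfolding edge_int_def using f g ends
    by (intro Bochner_Integration.integral_sum edge_prod_integrable) auto
  finally show ?thesis .
qed

text \<open>Hoelder bounds the term of \<open>X\<close> by one factor \<open>p f\<close> for each
  edge in \<open>X\<close> and one factor \<open>p g\<close> for each other edge. These bounds sum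
  to \<open>(p f + p g) ^ card E\<close>, and roots are taken only at the end.\<close>

lemma triangle_of_hoelder:
  assumes hoelder: "\<And>\<phi>. (\<And>e. e \<in> E \<Longrightarrow> \<phi> e \<in> weights) \<Longrightarrow>
      \<bar>edge_int \<phi>\<bar> ^ card E \<le> (\<Prod>e\<in>E. \<bar>edge_int (\<lambda>_. \<phi> e)\<bar>)"
    and E: "E \<noteq> {}" and f: "f \<in> weights" and g: "g \<in> weights"
  defines "p \<equiv> \<lambda>f. \<bar>edge_int (\<lambda>_. f)\<bar> powr (1 / real (card E))"
  shows "p (\<lambda>x. f x + g x) \<le> p f + p g"
proof -
  let ?n = "card E"
  have n: "0 < ?n" using E finite_E by auto
  have p_nonneg: "0 \<le> p h" for h by (simp add: p_def)
  have p_power: "p h ^ ?n = \<bar>edge_int (\<lambda>_. h)\<bar>" for h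
    using n by (cases "edge_int (\<lambda>_. h) = 0") (simp_all add: p_def zero_power powr_powr flip: powr_realpow)
  have mixed: "\<bar>edge_int (\<lambda>e. if e \<in> X then f else g)\<bar> \<le> (\<Prod>e\<in>X. p f) * (\<Prod>e\<in>E - X. p g)"
    if X: "X \<subseteq> E" for X
  proof -
    have "\<bar>edge_int (\<lambda>e. if e \<in> X then f else g)\<bar> ^ ?n
        \<le> (\<Prod>e\<in>E. p (if e \<in> X then f else g) ^ ?n)"
      using hoelder[of "\<lambda>e. if e \<in> X then f else g"] f g unfolding p_power by simp
    also have "\<dots> = (\<Prod>e\<in>E. p (if e \<in> X then f else g)) ^ ?n"
      by (simp add: prod_power_distrib)
    finally have "\<bar>edge_int (\<lambda>e. if e \<in> X then f else g)\<bar> \<le> (\<Prod>e\<in>E. p (if e \<in> X then f else g))"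
      using n p_nonneg by (subst (asm) power_mono_iff) (auto intro!: prod_nonneg)
    also have "\<dots> = (\<Prod>e\<in>X. p f) * (\<Prod>e\<in>E - X. p g)"
      unfolding prod.subset_diff[OF X finite_E]
      by (subst mult.commute) (auto intro!: arg_cong2[where f = "(*)"] prod.cong simp del: prod_constant)
    finally show ?thesis .
  qed
  have "p (\<lambda>x. f x + g x) ^ ?n = \<bar>\<Sum>X\<in>Pow E. edge_int (\<lambda>e. if e \<in> X then f else g)\<bar>"
    unfolding p_power edge_int_add[OF f g] ..
  also have "\<dots> \<le> (\<Sum>X\<in>Pow E. \<bar>edge_int (\<lambda>e. if e \<in> X then f else g)\<bar>)"
    by (rule sum_abs)
  also have "\<dots> \<le> (\<Sum>X\<in>Pow E. (\<Prod>e\<in>X. p f) * (\<Prod>e\<in>E - X. p g))"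
    by (rule sum_mono) (use mixed in auto)
  also have "\<dots> = (\<Prod>e\<in>E. p f + p g)"
    by (rule prod_add[OF finite_E, symmetric])
  also have "\<dots> = (p f + p g) ^ ?n" by simp
  finally show ?thesis
    using n p_nonneg by (subst (asm) power_mono_iff) auto
qed

end

text \<open>Null sets are invisible to the integrals, so Borel weights suffice.\<close>

lemma norming_of_hoelder:
  fixes H :: "('a, 'b) bipartite_graph" and E :: "'e set" and i :: "'e \<Rightarrow> 'a" and j :: "'e \<Rightarrow> 'b"
  defines "l \<equiv> \<lambda>e. Inl (i e)" and "r \<equiv> \<lambda>e. Inr (j e)"
  assumes int: "edge_integral unit_measure (vertices H) E l r"
    and E: "E \<noteq> {}" and bij: "bij_betw (\<lambda>e. (i e, j e)) E (edges H)"
    and hoelder: "\<And>\<phi>. (\<And>e. e \<in> E \<Longrightarrow> \<phi> e \<in> edge_integral.weights unit_measure) \<Longrightarrow>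
      \<bar>edge_integral.edge_int unit_measure (vertices H) E l r \<phi>\<bar> ^ card E
      \<le> (\<Prod>e\<in>E. \<bar>edge_integral.edge_int unit_measure (vertices H) E l r (\<lambda>_. \<phi> e)\<bar>)"
  shows "norming H"
proof -
  interpret edge_integral unit_measure "vertices H" E l r by (rule int)
  have card: "card (edges H) = card E" using bij_betw_same_card[OF bij] by simp
  have n: "0 < card E" using E finite_E by auto
  have integrand: "(\<Prod>(a, b)\<in>edges H. f (x (Inl a), x (Inr b))) = edge_prod E (\<lambda>_. f) x"
    for f :: "real \<times> real \<Rightarrow> real" and x
    unfolding edge_prod_def prod.reindex_bij_betw[OF bij, symmetric] by (simp add: l_def r_def)
  have norm_eq: "graph_norm H f = \<bar>edge_int (\<lambda>_. g)\<bar> powr (1 / real (card E))"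
    if g: "g \<in> weights" and AE: "AE p in unit_measure \<Otimes>\<^sub>M unit_measure. f p = g p" for f g
  proof -
    let ?M = "\<Pi>\<^sub>M v\<in>vertices H. unit_measure"
    have "AE x in ?M. \<forall>e\<in>E. f (x (l e), x (r e)) = g (x (l e), x (r e))"
      using finite_E ends AE by (intro AE_finite_allI unit.AE_PiM_pair) (auto simp: l_def r_def)
    then have AE': "AE x in ?M. edge_prod E (\<lambda>_. f) x = edge_prod E (\<lambda>_. g) x"
      by eventually_elim (simp add: edge_prod_def)
    have m: "edge_prod E (\<lambda>_. g) \<in> borel_measurable ?M"
      using g ends by (intro edge_prod_measurable) auto
    have "(LINT x|completion ?M. edge_prod E (\<lambda>_. f) x) = (LINT x|completion ?M. edge_prod E (\<lambda>_. g) x)"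
      using borel_measurable_completion_AE[OF m AE'] m AE'
      by (intro integral_cong_AE AE_completion) (auto intro: measurable_completion)
    also have "\<dots> = edge_int (\<lambda>_. g)"
      unfolding edge_int_def by (rule integral_completion[OF m])
    finally show ?thesis
      by (simp add: graph_norm_def cube_measure_def integrand card)
  qed
  have repr: "\<exists>g\<in>weights. AE p in unit_measure \<Otimes>\<^sub>M unit_measure. f p = g p"
    if "f \<in> bounded_measurable" for f
    using borel_representative[OF that] by (auto simp: weights_def)
  show ?thesis
    unfolding norming_def seminorm_on_def
  proof (intro conjI ballI allI)
    fix f :: "real \<times> real \<Rightarrow> real" and c :: real
    show "0 \<le> graph_norm H f" by (simp add: graph_norm_def)
    have "edge_prod E (\<lambda>_ p. c * f p) x = c ^ card E * edge_prod E (\<lambda>_. f) x" for x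
      by (simp add: edge_prod_def prod.distrib)
    then have "graph_norm H (\<lambda>x. c * f x)
        = (\<bar>c\<bar> ^ card E * \<bar>LINT x|cube_measure (vertices H). edge_prod E (\<lambda>_. f) x\<bar>) powr (1 / real (card E))"
      unfolding graph_norm_def integrand[of "\<lambda>x. c * f x"] card by (simp add: abs_mult power_abs)
    moreover have "(\<bar>c\<bar> ^ card E) powr (1 / real (card E)) = \<bar>c\<bar>"
      using n by (cases "c = 0") (simp_all add: zero_power powr_powr flip: powr_realpow)
    ultimately show "graph_norm H (\<lambda>x. c * f x) = \<bar>c\<bar> * graph_norm H f"
      by (simp add: graph_norm_def integrand card powr_mult)
  next
    fix f f' :: "real \<times> real \<Rightarrow> real"
    assume "f \<in> bounded_measurable" "f' \<in> bounded_measurable"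
    then obtain g g' where g: "g \<in> weights" "AE p in unit_measure \<Otimes>\<^sub>M unit_measure. f p = g p"
      and g': "g' \<in> weights" "AE p in unit_measure \<Otimes>\<^sub>M unit_measure. f' p = g' p"
      using repr by meson
    have "(\<lambda>p. g p + g' p) \<in> weights"
    proof -
      obtain B B' where "\<And>p. \<bar>g p\<bar> \<le> B" "\<And>p. \<bar>g' p\<bar> \<le> B'"
        using g(1) g'(1) by (auto simp: weights_def)
      then have "\<bar>g p + g' p\<bar> \<le> B + B'" for p
        by (meson abs_triangle_ineq add_mono order_trans)
      then show ?thesis using g(1) g'(1) by (auto simp: weights_def)
    qed
    moreover have "AE p in unit_measure \<Otimes>\<^sub>M unit_measure. f p + f' p = g p + g' p"
      using g(2) g'(2) by eventually_elim simp
    ultimately have "graph_norm H (\<lambda>x. f x + f' x)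
        = \<bar>edge_int (\<lambda>_ p. g p + g' p)\<bar> powr (1 / real (card E))"
      by (rule norm_eq)
    then show "graph_norm H (\<lambda>x. f x + f' x) \<le> graph_norm H f + graph_norm H f'"
      using triangle_of_hoelder[OF hoelder E g(1) g'(1)] norm_eq[OF g] norm_eq[OF g'] by simp
  qed
qed

section \<open>Reflection graphs\<close>

context simple_reflections
begin

lemma W_subset_carrier: "W \<subseteq> carrier GL"
  using subgroup.subset[OF subgroup_W] .

lemma subgroup_generate_simple:
  assumes "D \<subseteq> \<Delta>"
  shows "subgroup (generate GL (reflection ` D)) GL"
  using GL.generate_is_subgroup[OF simple_carrier[OF assms]] .

lemma coset_eq_iff:
  assumes D: "D \<subseteq> \<Delta>" and w: "w \<in> W" "w' \<in> W"
  shows "w <#\<^bsub>GL\<^esub> generate GL (reflection ` D) = w' <#\<^bsub>GL\<^esub> generate GL (reflection ` D)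
    \<longleftrightarrow> (\<exists>u\<in>generate GL (reflection ` D). w' = w ** u)" (is "w <#\<^bsub>GL\<^esub> ?G = _ \<longleftrightarrow> _")
proof
  assume eq: "w <#\<^bsub>GL\<^esub> ?G = w' <#\<^bsub>GL\<^esub> ?G"
  have "w' \<otimes>\<^bsub>GL\<^esub> \<one>\<^bsub>GL\<^esub> \<in> w' <#\<^bsub>GL\<^esub> ?G"
    unfolding l_coset_def using generate.one[of GL] by blast
  then show "\<exists>u\<in>?G. w' = w ** u"
    unfolding eq[symmetric] by (auto simp: l_coset_def)
next
  assume "\<exists>u\<in>?G. w' = w ** u"
  then have "w' \<in> w <#\<^bsub>GL\<^esub> ?G" by (auto simp: l_coset_def)
  moreover have "w \<in> carrier GL" using w W_subset_carrier by blast
  ultimately show "w <#\<^bsub>GL\<^esub> ?G = w' <#\<^bsub>GL\<^esub> ?G"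
    using GL.l_repr_independence[OF _ _ subgroup_generate_simple[OF D]] by blast
qed

lemma coset_contains: "w \<in> w <#\<^bsub>GL\<^esub> generate GL (reflection ` D)"
proof -
  have "w \<otimes>\<^bsub>GL\<^esub> \<one>\<^bsub>GL\<^esub> \<in> w <#\<^bsub>GL\<^esub> generate GL (reflection ` D)"
    unfolding l_coset_def using generate.one[of GL] by blast
  then show ?thesis by simp
qed

lemma coset_subset_W:
  assumes "D \<subseteq> \<Delta>" "w \<in> W"
  shows "w <#\<^bsub>GL\<^esub> generate GL (reflection ` D) \<subseteq> W"
  using generate_simple_subset[OF assms(1)] assms(2) by (auto simp: l_coset_def intro!: mult_W)

lemma reflection_l_coset:
  assumes "D \<subseteq> \<Delta>" "w \<in> W" "a \<in> roots W"
  shows "reflection a <#\<^bsub>GL\<^esub> (w <#\<^bsub>GL\<^esub> generate GL (reflection ` D))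
    = (reflection a ** w) <#\<^bsub>GL\<^esub> generate GL (reflection ` D)"
proof -
  have "generate GL (reflection ` D) \<subseteq> carrier GL"
    using generate_simple_subset[OF assms(1)] W_subset_carrier by blast
  moreover have "reflection a \<in> carrier GL" "w \<in> carrier GL"
    using assms reflection_in_W W_subset_carrier by blast+
  ultimately show ?thesis
    by (simp add: GL.lcos_m_assoc)
qed

text \<open>The hyperplane of \<open>a\<close> cuts through the face of a chamber that a coset stands for exactly
  when the reflection in \<open>a\<close> fixes that coset.\<close>

lemma coset_cut:
  assumes D: "D \<subseteq> \<Delta>" and w: "w \<in> W" and a: "a \<in> roots W"
    and cut: "\<not> w <#\<^bsub>GL\<^esub> generate GL (reflection ` D) \<subseteq> side a"
      "\<not> w <#\<^bsub>GL\<^esub> generate GL (reflection ` D) \<subseteq> W - side a"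
  shows "reflection a <#\<^bsub>GL\<^esub> (w <#\<^bsub>GL\<^esub> generate GL (reflection ` D))
    = w <#\<^bsub>GL\<^esub> generate GL (reflection ` D)"
proof -
  let ?G = "generate GL (reflection ` D)"
  obtain x y where x: "x \<in> w <#\<^bsub>GL\<^esub> ?G" "x \<in> side a" and y: "y \<in> w <#\<^bsub>GL\<^esub> ?G" "y \<notin> side a"
    using cut coset_subset_W[OF D w] by blast
  have xW: "x \<in> W" "y \<in> W" using x y coset_subset_W[OF D w] by auto
  have cx: "w <#\<^bsub>GL\<^esub> ?G = x <#\<^bsub>GL\<^esub> ?G" and cy: "w <#\<^bsub>GL\<^esub> ?G = y <#\<^bsub>GL\<^esub> ?G"
    using coset_eq_iff[OF D w] xW x(1) y(1) by (auto simp: l_coset_def)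
  then obtain u where "u \<in> ?G" "y = x ** u"
    using coset_eq_iff[OF D xW] by auto
  then obtain v where "v \<in> ?G" "reflection a ** x = x ** v"
    using reflection_coset[OF D a x(2)] y(2) by blast
  then have "x <#\<^bsub>GL\<^esub> ?G = (reflection a ** x) <#\<^bsub>GL\<^esub> ?G"
    using coset_eq_iff[OF D xW(1) mult_W[OF reflection_in_W[OF a] xW(1)]] by blast
  then show ?thesis
    unfolding cx using reflection_l_coset[OF D xW(1) a] by simp
qed

lemma reflection_W_involution: "a \<in> roots W \<Longrightarrow> reflection a ** (reflection a ** w) = w"
  for w :: "real^'n^'n"
  using reflection_involution[OF root_neq_0] by (simp add: matrix_mul_assoc)

text \<open>All roots are used, not only positive ones: \<open>- a\<close> has the same reflection
  and supplies the complementary half.\<close>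

definition folds :: "((real^'n^'n) set \<times> (real^'n^'n \<Rightarrow> real^'n^'n)) set" where
  "folds = (\<lambda>a. (side a, (**) (reflection a))) ` roots W"

lemma percolating_folds_sides:
  "percolating_folds W folds
    (\<lambda>w0 w. (w *v rho) \<bullet> (w0 *v rho))"
proof
  show "finite W" by (rule finite_W)
next
  fix P :: "(real^'n^'n) set" and \<tau>
  assume T: "(P, \<tau>) \<in> folds"
  then obtain a where a: "a \<in> roots W" "P = side a" "\<tau> = (**) (reflection a)"
    by (auto simp: folds_def)
  show "P \<subseteq> W" using a by (auto simp: side_def)
  show "(W - P, \<tau>) \<in> folds"
    using a minus_root[OF a(1)] side_minus[OF a(1)] reflection_minus[of a]
    unfolding folds_def by (intro image_eqI[of _ _ "- a"]) auto
  show "\<tau> w \<in> P" if "w \<in> W - P" for w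
    using that a reflection_side by auto
  show "\<tau> (\<tau> w) = w" for w
    using a reflection_W_involution by simp
  show "(w *v rho) \<bullet> (w0 *v rho) < (\<tau> w *v rho) \<bullet> (w0 *v rho)" if "w0 \<in> P" "w \<in> W - P" for w0 w
    using reflection_increases_height a that by auto
next
  fix w0 w assume "w0 \<in> W" "w \<in> W" "w \<noteq> w0"
  then show "\<exists>(P, \<tau>)\<in>folds. w0 \<in> P \<and> w \<notin> P"
    using sides_separate[of w0 w] by (auto simp: folds_def)
qed

theorem reflection_graph_norming:
  assumes D: "D1 \<subseteq> \<Delta>" "D2 \<subseteq> \<Delta>" "D1 \<inter> D2 = {}"
  shows "norming (reflection_graph (reflection ` D1) (reflection ` D2) W)"
proof -
  define G1 G2 where "G1 = generate GL (reflection ` D1)" and "G2 = generate GL (reflection ` D2)"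
  define H where "H = reflection_graph (reflection ` D1) (reflection ` D2) W"
  define i j where "i w = w <#\<^bsub>GL\<^esub> G1" and "j w = w <#\<^bsub>GL\<^esub> G2" for w :: "real^'n^'n"
  define l r :: "real^'n^'n \<Rightarrow> (real^'n^'n) set + (real^'n^'n) set"
    where "l w = Inl (i w)" and "r w = Inr (j w)" for w
  let ?V = "vertices H"
  have H: "left_part H = i ` W" "right_part H = j ` W" "edges H = (\<lambda>w. (i w, j w)) ` W"
    by (simp_all add: H_def reflection_graph_def G1_def G2_def i_def j_def Let_def)
  have V: "?V = l ` W \<union> r ` W"
    by (auto simp: vertices_def H l_def r_def)
  interpret edge_integral unit_measure ?V W l r
    by standard (auto simp: V finite_W)
  interpret percolating_folds W "folds"
      "\<lambda>w0 w. (w *v rho) \<bullet> (w0 *v rho)"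
    by (rule percolating_folds_sides)
  \<comment> \<open>Two elements with the same cosets differ by an element of both subgroups, which
    is the identity.\<close>
  have inj: "w = w'" if ww: "w \<in> W" "w' \<in> W" "i w = i w'" "j w = j w'" for w w'
  proof -
    obtain u where u: "u \<in> G1" "w' = w ** u"
      using ww(3) coset_eq_iff[OF D(1) ww(1,2)] by (auto simp: i_def G1_def)
    obtain v where v: "v \<in> G2" "w' = w ** v"
      using ww(4) coset_eq_iff[OF D(2) ww(1,2)] by (auto simp: j_def G2_def)
    have "u = v"
      using u v mult_transpose_W(2)[OF ww(1)] by (metis matrix_mul_assoc matrix_mul_lid)
    then have "u = mat 1"
      using generate_simple_disjoint[OF D] u v by (simp add: G1_def G2_def)
    then show ?thesis using u by simp
  qed
  have bij: "bij_betw (\<lambda>w. (i w, j w)) W (edges H)"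
    using inj by (auto simp: bij_betw_def H intro!: inj_onI)
  have fold: "(edge_int \<phi>)\<^sup>2 \<le> edge_int (fold_along P \<tau> \<phi>) * edge_int (fold_along (W - P) \<tau> \<phi>)"
    if \<phi>: "\<phi> ` W \<subseteq> weights" and T: "(P, \<tau>) \<in> folds" for \<phi> P \<tau>
  proof -
    obtain a where a: "a \<in> roots W" "P = side a" "\<tau> = (**) (reflection a)"
      using T by (auto simp: folds_def)
    define cells where "cells = case_sum (\<lambda>x :: (real^'n^'n) set. x) (\<lambda>x. x)"
    define \<sigma> where "\<sigma> = map_sum (\<lambda>x. reflection a <#\<^bsub>GL\<^esub> x) (\<lambda>x. reflection a <#\<^bsub>GL\<^esub> x)"
    \<comment> \<open>\<open>R\<close> and \<open>R'\<close> collect the cosets lying entirely on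
      one side. Those in \<open>F\<close> are cut by the hyperplane, hence fixed by \<sigma>
      according to \<open>coset_cut\<close>.\<close>
    define R R' F where "R = {v \<in> ?V. cells v \<subseteq> side a}" and "R' = {v \<in> ?V. cells v \<subseteq> W - side a}"
      and "F = ?V - R - R'"
    have refl_W: "reflection a ** w \<in> W" if "w \<in> W" for w
      using that a mult_W reflection_in_W by blast
    have \<sigma>_ends: "\<sigma> (l w) = l (reflection a ** w)" "\<sigma> (r w) = r (reflection a ** w)" if "w \<in> W" for w
      using reflection_l_coset[OF D(1) that a(1)] reflection_l_coset[OF D(2) that a(1)]
      by (simp_all add: \<sigma>_def l_def r_def i_def j_def G1_def G2_def)
    have \<sigma>_V: "\<sigma> v \<in> ?V" "\<sigma> (\<sigma> v) = v" if "v \<in> ?V" for v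
      using that \<sigma>_ends refl_W reflection_W_involution[OF a(1)] by (auto simp: V)
    have cells_\<sigma>: "cells (\<sigma> v) = (**) (reflection a) ` cells v" for v
      by (cases v) (auto simp: cells_def \<sigma>_def l_coset_def)
    have cells_W: "cells v \<subseteq> W" if "v \<in> ?V" for v
    proof -
      obtain w where "w \<in> W" "v = l w \<or> v = r w" using \<open>v \<in> ?V\<close> by (auto simp: V)
      then show ?thesis
        using coset_subset_W[OF D(1), of w] coset_subset_W[OF D(2), of w]
        by (elim disjE) (simp_all add: cells_def l_def r_def i_def j_def G1_def G2_def)
    qed
    have cells_ends: "w \<in> cells (l w)" "w \<in> cells (r w)" for w
      using coset_contains by (simp_all add: cells_def l_def r_def i_def j_def G1_def G2_def)
    have refl_side: "reflection a ** w \<in> side a \<longleftrightarrow> w \<notin> side a" if "w \<in> W" for w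
      using reflection_side a that by blast
    have \<sigma>_swap: "\<sigma> v \<in> R' \<longleftrightarrow> v \<in> R" "\<sigma> v \<in> R \<longleftrightarrow> v \<in> R'" if "v \<in> ?V" for v
    proof -
      have "(\<forall>w\<in>cells v. reflection a ** w \<in> W - side a) \<longleftrightarrow> (\<forall>w\<in>cells v. w \<in> side a)"
        "(\<forall>w\<in>cells v. reflection a ** w \<in> side a) \<longleftrightarrow> (\<forall>w\<in>cells v. w \<in> W - side a)"
        using cells_W[OF that] refl_side refl_W by (auto intro!: ball_cong)
      then show "\<sigma> v \<in> R' \<longleftrightarrow> v \<in> R" "\<sigma> v \<in> R \<longleftrightarrow> v \<in> R'"
        using that \<sigma>_V(1)[OF that] by (simp_all add: R_def R'_def cells_\<sigma> subset_eq)
    qed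
    \<comment> \<open>Both ends of the edge \<open>w\<close> are cosets containing \<open>w\<close>,
      so neither can lie entirely on the far side.\<close>
    have ends_notin: "l w \<in> F \<union> R \<and> r w \<in> F \<union> R" if "w \<in> side a" for w
      using that cells_ends[of w] by (auto simp: F_def R'_def V side_def)
    show ?thesis
      unfolding a(2)
    proof (rule edge_int_fold[of F R R' \<sigma>])
      show "?V = F \<union> R \<union> R'" "F \<inter> R = {}" "F \<inter> R' = {}"
        by (auto simp: F_def R_def R'_def)
      show "R \<inter> R' = {}"
        using cells_ends by (auto simp: R_def R'_def V)
      show "\<sigma> v = v" if "v \<in> F" for v
      proof -
        obtain w where w: "w \<in> W" "v = l w \<or> v = r w" using \<open>v \<in> F\<close> by (auto simp: F_def V)
        have "\<not> cells v \<subseteq> side a" "\<not> cells v \<subseteq> W - side a"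
          using \<open>v \<in> F\<close> by (auto simp: F_def R_def R'_def)
        then show ?thesis
          using w(2) coset_cut[OF D(1) w(1) a(1)] coset_cut[OF D(2) w(1) a(1)]
          by (elim disjE) (simp_all add: \<sigma>_def cells_def l_def r_def i_def j_def G1_def G2_def)
      qed
      have "R \<subseteq> ?V" "R' \<subseteq> ?V" by (auto simp: R_def R'_def)
      then show "bij_betw \<sigma> R R'"
        using \<sigma>_V(2) \<sigma>_swap by (intro bij_betw_byWitness[where f' = \<sigma>]) (auto simp: subset_iff)
      show "side a \<subseteq> W" by (auto simp: side_def)
      show "\<tau> (\<tau> w) = w" for w using a reflection_W_involution by simp
      show "\<tau> w \<in> W \<and> (\<tau> w \<in> side a \<longleftrightarrow> w \<notin> side a)" if "w \<in> W" for w
        using that refl_W refl_side a by simp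
      show "l w \<in> F \<union> R \<and> r w \<in> F \<union> R" if "w \<in> side a" for w
        using that by (rule ends_notin)
      show "l (\<tau> w) = \<sigma> (l w) \<and> r (\<tau> w) = \<sigma> (r w)" if "w \<in> side a" for w
        using \<sigma>_ends[of w] that a by (simp add: side_def)
      show "\<phi> w \<in> weights" if "w \<in> W" for w using \<phi> that by auto
    qed
  qed
  have "norming H"
  proof (rule norming_of_hoelder[of H W i j])
    show "edge_integral unit_measure ?V W (\<lambda>w. Inl (i w)) (\<lambda>w. Inr (j w))"
      using edge_integral_axioms by (simp add: l_def[abs_def] r_def[abs_def])
    show "W \<noteq> {}" using one_W by auto
    show "bij_betw (\<lambda>w. (i w, j w)) W (edges H)" by (rule bij)
    fix \<phi> assume "\<And>w. w \<in> W \<Longrightarrow> \<phi> w \<in> weights"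
    then have \<phi>: "\<phi> ` W \<subseteq> weights" by auto
    \<comment> \<open>The abstract inequality needs a nonnegative functional, hence the absolute
      value.\<close>
    have "\<bar>edge_int \<phi>\<bar> ^ card W \<le> (\<Prod>w\<in>W. \<bar>edge_int (\<lambda>_. \<phi> w)\<bar>)"
    proof (rule hoelder[where X = weights])
      show "\<bar>edge_int \<phi>\<bar> = \<bar>edge_int \<psi>\<bar>" if "\<And>e. e \<in> W \<Longrightarrow> \<phi> e = \<psi> e" for \<phi> \<psi>
        using edge_int_cong[of \<phi> \<psi>] that by simp
      show "\<bar>edge_int \<psi>\<bar>\<^sup>2 \<le> \<bar>edge_int (fold_along P \<tau> \<psi>)\<bar> * \<bar>edge_int (fold_along (W - P) \<tau> \<psi>)\<bar>"
        if "\<psi> ` W \<subseteq> weights" "(P, \<tau>) \<in> folds" for \<psi> P \<tau>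
        using fold[OF that] by (simp flip: abs_mult)
    qed (use \<phi> in auto)
    then show "\<bar>edge_integral.edge_int unit_measure ?V W (\<lambda>w. Inl (i w)) (\<lambda>w. Inr (j w)) \<phi>\<bar> ^ card W
        \<le> (\<Prod>w\<in>W. \<bar>edge_integral.edge_int unit_measure ?V W (\<lambda>w. Inl (i w)) (\<lambda>w. Inr (j w)) (\<lambda>_. \<phi> w)\<bar>)"
      by (simp add: l_def[abs_def] r_def[abs_def])
  qed
  then show ?thesis by (simp add: H_def)
qed

end

section \<open>The lexicographic order as an instance of the abstract positivity\<close>

lemma positive_wrt_add:
  assumes bs: "ordered_basis bs" and x: "positive_wrt bs x" and y: "positive_wrt bs y"
  shows "positive_wrt bs (x + y)"
proof -
  have rep: "representation (set bs) (x + y) b = representation (set bs) x b + representation (set bs) y b" for b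
    using bs by (simp add: ordered_basis_def representation_add)
  obtain m where m: "m < length bs" "representation (set bs) x (bs ! m) > 0"
      "\<forall>k<m. representation (set bs) x (bs ! k) = 0"
    using x by (auto simp: positive_wrt_def)
  obtain n where n: "n < length bs" "representation (set bs) y (bs ! n) > 0"
      "\<forall>k<n. representation (set bs) y (bs ! k) = 0"
    using y by (auto simp: positive_wrt_def)
  show ?thesis
    unfolding positive_wrt_def rep
  \<comment> \<open>The first nonzero coordinate of the sum sits at the earlier of the two leading
    positions; if these agree, two positive numbers are added.\<close>
  proof (intro exI[of _ "min m n"] conjI)
    show "0 < representation (set bs) x (bs ! min m n) + representation (set bs) y (bs ! min m n)"
      using m n by (cases m n rule: linorder_cases) (auto simp: min_def)
  qed (use m n in auto)
qed

lemma positive_wrt_scaleR: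
  assumes "ordered_basis bs" "0 < c" "positive_wrt bs x"
  shows "positive_wrt bs (c *\<^sub>R x)"
proof -
  have "representation (set bs) (c *\<^sub>R x) b = c * representation (set bs) x b" for b
    using assms(1) by (simp add: ordered_basis_def representation_scale)
  then show ?thesis using assms(2,3) by (auto simp: positive_wrt_def)
qed

lemma positive_wrt_cases:
  assumes bs: "ordered_basis bs" and x: "x \<noteq> 0"
  shows "positive_wrt bs x \<or> positive_wrt bs (- x)"
proof -
  let ?P = "\<lambda>k. k < length bs \<and> representation (set bs) x (bs ! k) \<noteq> 0"
  have ind: "independent (set bs)" "x \<in> span (set bs)" using bs by (simp_all add: ordered_basis_def)
  have rep: "representation (set bs) (- x) b = - representation (set bs) x b" for b
    using ind by (simp add: representation_neg)
  have "\<exists>k. ?P k"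
  proof (rule ccontr)
    assume "\<not> ?thesis"
    then have "representation (set bs) x b = 0" if "b \<in> set bs" for b
      using that by (auto simp: in_set_conv_nth)
    moreover have "(\<Sum>b\<in>set bs. representation (set bs) x b *\<^sub>R b) = x"
      using ind by (intro sum_representation_eq) auto
    ultimately show False using x by simp
  qed
  then have "\<exists>k. ?P k \<and> (\<forall>m<k. \<not> ?P m)"
    using exists_least_iff[of ?P] by blast
  then obtain k where k: "?P k" "\<And>m. m < k \<Longrightarrow> \<not> ?P m" by blast
  then have "\<forall>m<k. representation (set bs) x (bs ! m) = 0" by auto
  then show ?thesis
    unfolding positive_wrt_def rep using k(1)
    by (cases "representation (set bs) x (bs ! k) > 0") (auto intro!: exI[of _ k])
qed

theorem theorem1p3:
  fixes W :: "(real^'n^'n) set"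
    and bs :: "(real^'n) list"
    and \<Delta> :: "(real^'n) set"
    and S S1 S2 :: "(real^'n^'n) set"
  assumes "finite_reflection_group W"
    and "ordered_basis bs"
    and "simple_system bs W \<Delta>"
    and "S = reflection ` \<Delta>"
    and "S1 \<subseteq> S" and "S2 \<subseteq> S" and "S1 \<inter> S2 = {}"
  shows "norming (reflection_graph S1 S2 W)"
proof -
  interpret simple_reflections W "positive_wrt bs" \<Delta>
  proof
    show "finite_reflection_group W" by fact
    show "\<not> positive_wrt bs 0"
      by (simp add: positive_wrt_def representation_zero)
    show "positive_wrt bs (x + y)" if "positive_wrt bs x" "positive_wrt bs y" for x y
      using positive_wrt_add[OF assms(2) that] .
    show "positive_wrt bs (c *\<^sub>R x)" if "0 < c" "positive_wrt bs x" for c x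
      using positive_wrt_scaleR[OF assms(2) that] .
    show "positive_wrt bs x \<or> positive_wrt bs (- x)" if "x \<noteq> 0" for x
      using positive_wrt_cases[OF assms(2) that] .
    have pos: "positive_roots bs W = {a \<in> roots W. positive_wrt bs a}"
      by (simp add: positive_roots_def)
    show "\<Delta> \<subseteq> {a \<in> roots W. positive_wrt bs a}"
      "\<And>a. a \<in> roots W \<Longrightarrow> positive_wrt bs a \<Longrightarrow> nonneg_combination \<Delta> a"
      "\<And>D. D \<subset> \<Delta> \<Longrightarrow> \<exists>a\<in>roots W. positive_wrt bs a \<and> \<not> nonneg_combination D a"
      using assms(3) unfolding simple_system_def pos by blast+
  qed
  \<comment> \<open>The earlier results speak of sets of simple roots, the theorem of sets of
    matrices. Full preimages in \<Delta> keep the two sets disjoint.\<close>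
  define D1 D2 where "D1 = {d \<in> \<Delta>. reflection d \<in> S1}" and "D2 = {d \<in> \<Delta>. reflection d \<in> S2}"
  have "S1 = reflection ` D1" "S2 = reflection ` D2" "D1 \<inter> D2 = {}"
    using assms(4-7) by (auto simp: D1_def D2_def)
  then show ?thesis
    using reflection_graph_norming[of D1 D2] by (auto simp: D1_def D2_def)
qed

end
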